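(* The species $\mathbb{CP}_\triangledown$ of $\triangledown$-compatible posets is a suboperad of $(\mathbb P,\blacktriangledown)$. It is generated by the elements $m\in\mathbb P_{\{1,2\}}$, the two-element antichain on $\{1,2\}$, and $\triangledown\in\mathbb P_{\{1,2\}}$, the chain $2<1$, and the relations $$m^{(12)}=m,\qquad m\blacktriangledown_1m=m\blacktriangledown_2m,\qquad \triangledown\blacktriangledown_1m=\triangledown\blacktriangledown_2\triangledown,$$ that is, $\mathbb{CP}_\triangledown$ is presented, as an operad, by these generators and relations.
   Context: Fix a base field. $\mathbb P$ is the linear species of finite nonempty posets: $\mathbb P_A$ is the vector space freely generated by all partial orders on the finite nonempty set $A$, with bijections acting by relabelling. $(\mathbb P,\blacktriangledown)$ is the operad whose partial compositions are, for posets $\mathcal A=(A,\le_A)$, $\mathcal B=(B,\le_B)$ with $A\cap B=\emptyset$ and $a\in A$: $\mathcal A\blacktriangledown_a\mathcal B$ is the set $(A\setminus\{a\})\sqcup B$ with $x\le y$ iff ($x,y\in B$, $x\le_By$) or ($x,y\in A\setminus\{a\}$, $x\le_Ay$) or ($x\in A\setminus\{a\}$, $y\in B$, $x\le_Aa$) or ($x\in\min(\mathcal B)$, $y\in A\setminus\{a\}$, $a\le_Ay$). The units are the one-point posets. For elements with label sets $\{1,\dots,p\}$ and $\{1,\dots,q\}$, $f\blacktriangledown_ig$ is understood with the usual relabelling onto $\{1,\dots,p+q-1\}$ (labels of $g$ shifted by $i-1$, labels $j>i$ of $f$ shifted by $q-1$). $m^{(12)}$ is the image of $m$ under exchanging labels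 $1$ and $2$. For posets $\mathcal A,\mathcal B$ on disjoint sets, $\mathcal A\triangledown\mathcal B$ is $A\sqcup B$ with the orders of $\mathcal A$ and $\mathcal B$ together with $x\le y$ for all $x\in\min(\mathcal B)$, $y\in A$ (and no other relations). For a finite poset $\mathcal A=(A,\le_A)$ let $A'=\{y\in A\mid\forall x\in\min(\mathcal A),\ x<_Ay\}$, and let $b\mathcal A=\mathcal A_{|A'}$, $r\mathcal A=\mathcal A_{|A\setminus A'}$ (induced orders). $\triangledown$-compatible posets are defined inductively on cardinality $n\geq 1$: a one-element poset is $\triangledown$-compatible; if $n\ge2$, $\mathcal A$ is $\triangledown$-compatible iff either (1) $\mathcal A$ is not connected (Hasse diagram not connected) and all its connected components are $\triangledown$-compatible, or (2) $\mathcal A$ is connected, $b\mathcal A$ is nonempty, $b\mathcal A$ and $r\mathcal A$ are $\triangledown$-compatible, and $\mathcal A=b\mathcal A\triangledown r\mathcal A$. $(\mathbb{CP}_\triangledown)_A\subseteq\mathbb P_A$ is the subspace generated by the $\triangledown$-compatible posets on $A$. *)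

theory Defs
  imports Complex_Main "HOL-Library.Poly_Mapping" "HOL-Combinatorics.Transposition"
begin

section \<open>Free vector spaces\<close>

text \<open>The vector space freely generated by a set of elements of type \<open>'b\<close> consists of the
  finitely supported functions \<open>'b \<Rightarrow>\<^sub>0 'k\<close> whose support lies in that set.\<close>

definition scale :: "'k::field \<Rightarrow> ('b \<Rightarrow>\<^sub>0 'k) \<Rightarrow> ('b \<Rightarrow>\<^sub>0 'k)" where
  "scale c p = Poly_Mapping.map ((*) c) p"

definition basis :: "'b \<Rightarrow> ('b \<Rightarrow>\<^sub>0 'k::field)" where
  "basis b = Poly_Mapping.single b 1"

definition lin :: "('b \<Rightarrow> 'c) \<Rightarrow> ('b \<Rightarrow>\<^sub>0 'k::field) \<Rightarrow> ('c \<Rightarrow>\<^sub>0 'k)" where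
  "lin f p = (\<Sum>b\<in>Poly_Mapping.keys p. scale (Poly_Mapping.lookup p b) (basis (f b)))"

definition bilin ::
  "('b \<Rightarrow> 'c \<Rightarrow> 'd) \<Rightarrow> ('b \<Rightarrow>\<^sub>0 'k::field) \<Rightarrow> ('c \<Rightarrow>\<^sub>0 'k) \<Rightarrow> ('d \<Rightarrow>\<^sub>0 'k)" where
  "bilin f p q = (\<Sum>b\<in>Poly_Mapping.keys p. \<Sum>c\<in>Poly_Mapping.keys q.
     scale (Poly_Mapping.lookup p b * Poly_Mapping.lookup q c) (basis (f b c)))"

lemma lookup_scale: "Poly_Mapping.lookup (scale c p) b = c * Poly_Mapping.lookup p b"
  by (simp add: scale_def Poly_Mapping.map.rep_eq when_def)

lemma vector_space_scale: "vector_space scale"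
  by unfold_locales
    (auto intro!: poly_mapping_eqI simp: lookup_scale lookup_add algebra_simps)


section \<open>Linear operads in species\<close>

text \<open>Label sets are the finite nonempty subsets of \<open>nat\<close>. The component on the label set \<open>A\<close>
  is a subspace of the ambient type \<open>'v\<close>; a bijection \<open>A \<rightarrow> B\<close> is represented by any function
  that restricts to it. \<open>pcomp P a x y\<close> is the partial composition \<open>x \<circ>\<^sub>a y\<close>; it is only
  meaningful for \<open>x\<close> in component \<open>A\<close> and \<open>y\<close> in component \<open>B\<close> with \<open>a \<in> A\<close> and \<open>A\<close>, \<open>B\<close>
  disjoint.\<close>

abbreviation label_set :: "nat set \<Rightarrow> bool" where
  "label_set A \<equiv> finite A \<and> A \<noteq> {}"

record ('k, 'v) operad_data =
  smult :: "'k \<Rightarrow> 'v \<Rightarrow> 'v"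
  component :: "nat set \<Rightarrow> 'v set"
  relabel :: "(nat \<Rightarrow> nat) \<Rightarrow> 'v \<Rightarrow> 'v"
  pcomp :: "nat \<Rightarrow> 'v \<Rightarrow> 'v \<Rightarrow> 'v"
  ounit :: "nat \<Rightarrow> 'v"

locale operad = vector_space "smult P"
  for P :: "('k::field, 'v::ab_group_add) operad_data" +
  assumes component_subspace: "label_set A \<Longrightarrow> subspace (component P A)"
    and relabel_closed:
      "\<lbrakk>label_set A; bij_betw \<sigma> A B; x \<in> component P A\<rbrakk> \<Longrightarrow> relabel P \<sigma> x \<in> component P B"
    and relabel_add:
      "\<lbrakk>label_set A; bij_betw \<sigma> A B; x \<in> component P A; y \<in> component P A\<rbrakk>
        \<Longrightarrow> relabel P \<sigma> (x + y) = relabel P \<sigma> x + relabel P \<sigma> y"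
    and relabel_smult:
      "\<lbrakk>label_set A; bij_betw \<sigma> A B; x \<in> component P A\<rbrakk>
        \<Longrightarrow> relabel P \<sigma> (smult P c x) = smult P c (relabel P \<sigma> x)"
    and relabel_cong:
      "\<lbrakk>label_set A; bij_betw \<sigma> A B; \<And>i. i \<in> A \<Longrightarrow> \<sigma> i = \<tau> i; x \<in> component P A\<rbrakk>
        \<Longrightarrow> relabel P \<sigma> x = relabel P \<tau> x"
    and relabel_id: "\<lbrakk>label_set A; x \<in> component P A\<rbrakk> \<Longrightarrow> relabel P id x = x"
    and relabel_comp:
      "\<lbrakk>label_set A; bij_betw \<sigma> A B; bij_betw \<tau> B C; x \<in> component P A\<rbrakk>
        \<Longrightarrow> relabel P \<tau> (relabel P \<sigma> x) = relabel P (\<tau> \<circ> \<sigma>) x"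
    and pcomp_closed:
      "\<lbrakk>label_set A; label_set B; A \<inter> B = {}; a \<in> A; x \<in> component P A; y \<in> component P B\<rbrakk>
        \<Longrightarrow> pcomp P a x y \<in> component P ((A - {a}) \<union> B)"
    and pcomp_add_left:
      "\<lbrakk>label_set A; label_set B; A \<inter> B = {}; a \<in> A;
        x \<in> component P A; x' \<in> component P A; y \<in> component P B\<rbrakk>
        \<Longrightarrow> pcomp P a (x + x') y = pcomp P a x y + pcomp P a x' y"
    and pcomp_smult_left:
      "\<lbrakk>label_set A; label_set B; A \<inter> B = {}; a \<in> A; x \<in> component P A; y \<in> component P B\<rbrakk>
        \<Longrightarrow> pcomp P a (smult P c x) y = smult P c (pcomp P a x y)"
    and pcomp_add_right:
      "\<lbrakk>label_set A; label_set B; A \<inter> B = {}; a \<in> A;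
        x \<in> component P A; y \<in> component P B; y' \<in> component P B\<rbrakk>
        \<Longrightarrow> pcomp P a x (y + y') = pcomp P a x y + pcomp P a x y'"
    and pcomp_smult_right:
      "\<lbrakk>label_set A; label_set B; A \<inter> B = {}; a \<in> A; x \<in> component P A; y \<in> component P B\<rbrakk>
        \<Longrightarrow> pcomp P a x (smult P c y) = smult P c (pcomp P a x y)"
    and pcomp_equivariant:
      "\<lbrakk>label_set A; label_set B; A \<inter> B = {}; a \<in> A; x \<in> component P A; y \<in> component P B;
        bij_betw \<sigma> A A'; bij_betw \<tau> B B'; A' \<inter> B' = {}\<rbrakk>
        \<Longrightarrow> pcomp P (\<sigma> a) (relabel P \<sigma> x) (relabel P \<tau> y)
          = relabel P (\<lambda>i. if i \<in> B then \<tau> i else \<sigma> i) (pcomp P a x y)"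
    and pcomp_sequential:
      "\<lbrakk>label_set A; label_set B; label_set C; A \<inter> B = {}; A \<inter> C = {}; B \<inter> C = {};
        a \<in> A; b \<in> B; x \<in> component P A; y \<in> component P B; z \<in> component P C\<rbrakk>
        \<Longrightarrow> pcomp P b (pcomp P a x y) z = pcomp P a x (pcomp P b y z)"
    and pcomp_parallel:
      "\<lbrakk>label_set A; label_set B; label_set C; A \<inter> B = {}; A \<inter> C = {}; B \<inter> C = {};
        a \<in> A; a' \<in> A; a \<noteq> a';
        x \<in> component P A; y \<in> component P B; z \<in> component P C\<rbrakk>
        \<Longrightarrow> pcomp P a' (pcomp P a x y) z = pcomp P a (pcomp P a' x z) y"
    and ounit_closed: "ounit P a \<in> component P {a}"
    and relabel_ounit: "relabel P \<sigma> (ounit P a) = ounit P (\<sigma> a)"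
    and ounit_left:
      "\<lbrakk>label_set B; a \<notin> B; y \<in> component P B\<rbrakk> \<Longrightarrow> pcomp P a (ounit P a) y = y"
    and ounit_right:
      "\<lbrakk>label_set A; a \<in> A; b \<notin> A; x \<in> component P A\<rbrakk>
        \<Longrightarrow> pcomp P a x (ounit P b) = relabel P (id(a := b)) x"

definition suboperad ::
  "('k::field, 'v::ab_group_add) operad_data \<Rightarrow> (nat set \<Rightarrow> 'v set) \<Rightarrow> bool" where
  "suboperad P S \<longleftrightarrow> operad P \<and>
     (\<forall>A. label_set A \<longrightarrow> S A \<subseteq> component P A \<and> module.subspace (smult P) (S A)) \<and>
     (\<forall>A B \<sigma>. label_set A \<and> bij_betw \<sigma> A B \<longrightarrow> (\<forall>x\<in>S A. relabel P \<sigma> x \<in> S B)) \<and>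
     (\<forall>a. ounit P a \<in> S {a}) \<and>
     (\<forall>A B a. label_set A \<and> label_set B \<and> A \<inter> B = {} \<and> a \<in> A \<longrightarrow>
       (\<forall>x\<in>S A. \<forall>y\<in>S B. pcomp P a x y \<in> S ((A - {a}) \<union> B)))"

definition generated_suboperad ::
  "('k::field, 'v::ab_group_add) operad_data \<Rightarrow> 'v set \<Rightarrow> nat set \<Rightarrow> 'v set" where
  "generated_suboperad P X A =
     \<Inter> {S A | S. suboperad P S \<and> (\<forall>B. label_set B \<longrightarrow> X \<inter> component P B \<subseteq> S B)}"

definition operadic_ideal ::
  "('k::field, 'v::ab_group_add) operad_data \<Rightarrow> (nat set \<Rightarrow> 'v set) \<Rightarrow> bool" where
  "operadic_ideal P J \<longleftrightarrow>
     (\<forall>A. label_set A \<longrightarrow> J A \<subseteq> component P A \<and> module.subspace (smult P) (J A)) \<and>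
     (\<forall>A B \<sigma>. label_set A \<and> bij_betw \<sigma> A B \<longrightarrow> (\<forall>x\<in>J A. relabel P \<sigma> x \<in> J B)) \<and>
     (\<forall>A B a. label_set A \<and> label_set B \<and> A \<inter> B = {} \<and> a \<in> A \<longrightarrow>
       (\<forall>x\<in>J A. \<forall>y\<in>component P B. pcomp P a x y \<in> J ((A - {a}) \<union> B)) \<and>
       (\<forall>x\<in>component P A. \<forall>y\<in>J B. pcomp P a x y \<in> J ((A - {a}) \<union> B)))"

definition generated_ideal ::
  "('k::field, 'v::ab_group_add) operad_data \<Rightarrow> 'v set \<Rightarrow> nat set \<Rightarrow> 'v set" where
  "generated_ideal P R A =
     \<Inter> {J A | J. operadic_ideal P J \<and> (\<forall>B. label_set B \<longrightarrow> R \<inter> component P B \<subseteq> J B)}"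

definition operad_morphism ::
  "('k::field, 'v::ab_group_add) operad_data \<Rightarrow> ('k, 'w::ab_group_add) operad_data
    \<Rightarrow> ('v \<Rightarrow> 'w) \<Rightarrow> bool" where
  "operad_morphism P Q \<phi> \<longleftrightarrow>
     (\<forall>A. label_set A \<longrightarrow>
       (\<forall>x\<in>component P A. \<phi> x \<in> component Q A) \<and>
       (\<forall>x\<in>component P A. \<forall>y\<in>component P A. \<phi> (x + y) = \<phi> x + \<phi> y) \<and>
       (\<forall>c. \<forall>x\<in>component P A. \<phi> (smult P c x) = smult Q c (\<phi> x))) \<and>
     (\<forall>A B \<sigma>. label_set A \<and> bij_betw \<sigma> A B \<longrightarrow>
       (\<forall>x\<in>component P A. \<phi> (relabel P \<sigma> x) = relabel Q \<sigma> (\<phi> x))) \<and>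
     (\<forall>a. \<phi> (ounit P a) = ounit Q a) \<and>
     (\<forall>A B a. label_set A \<and> label_set B \<and> A \<inter> B = {} \<and> a \<in> A \<longrightarrow>
       (\<forall>x\<in>component P A. \<forall>y\<in>component P B.
         \<phi> (pcomp P a x y) = pcomp Q a (\<phi> x) (\<phi> y)))"

text \<open>The composition \<open>f \<circ>\<^sub>i g\<close> for \<open>f\<close>, \<open>g\<close> with label sets \<open>{1..p}\<close>, \<open>{1..q}\<close>, with result on
  \<open>{1..p + q - 1}\<close>. Since \<open>i\<close> is also a label of the shifted \<open>g\<close>, the label \<open>i\<close> of \<open>f\<close> is
  first renamed to the unused label \<open>0\<close>.\<close>

definition numbered_pcomp ::
  "('k, 'v) operad_data \<Rightarrow> nat \<Rightarrow> nat \<Rightarrow> 'v \<Rightarrow> 'v \<Rightarrow> 'v" where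
  "numbered_pcomp P q i f g =
     pcomp P 0
       (relabel P (\<lambda>j. if j = i then 0 else if j > i then j + q - 1 else j) f)
       (relabel P (\<lambda>j. j + i - 1) g)"


section \<open>Free operads on binary generators and presentations\<close>

text \<open>The free operad on binary generators \<open>'g\<close>, without symmetry imposed on the generators:
  its component on \<open>A\<close> has as basis the planar binary trees with vertices decorated by
  generators and leaves bijectively labelled by \<open>A\<close>. Composition is grafting.\<close>

datatype ('g, 'l) tree = Leaf 'l | Node 'g "('g, 'l) tree" "('g, 'l) tree"

primrec leaves :: "('g, 'l) tree \<Rightarrow> 'l list" where
  "leaves (Leaf a) = [a]"
| "leaves (Node g s t) = leaves s @ leaves t"

primrec graft :: "'l \<Rightarrow> ('g, 'l) tree \<Rightarrow> ('g, 'l) tree \<Rightarrow> ('g, 'l) tree" where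
  "graft a (Leaf b) u = (if b = a then u else Leaf b)"
| "graft a (Node g s t) u = Node g (graft a s u) (graft a t u)"

definition trees_on :: "'l set \<Rightarrow> ('g, 'l) tree set" where
  "trees_on A = {t. distinct (leaves t) \<and> set (leaves t) = A}"

definition free_operad :: "('k::field, ('g, nat) tree \<Rightarrow>\<^sub>0 'k) operad_data" where
  "free_operad =
     \<lparr>smult = scale,
      component = (\<lambda>A. {p. Poly_Mapping.keys p \<subseteq> trees_on A}),
      relabel = (\<lambda>\<sigma>. lin (map_tree id \<sigma>)),
      pcomp = (\<lambda>a. bilin (graft a)),
      ounit = (\<lambda>a. basis (Leaf a))\<rparr>"

definition free_generator :: "'g \<Rightarrow> (('g, nat) tree \<Rightarrow>\<^sub>0 'k::field)" where
  "free_generator g = basis (Node g (Leaf 1) (Leaf 2))"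

text \<open>\<open>P\<close> is presented by the binary generators \<open>\<gamma> g\<close> (in the component on \<open>{1, 2}\<close>) and the
  relations \<open>r = 0\<close>, \<open>r \<in> R\<close>: the (unique) operad morphism from the free operad extending
  \<open>\<gamma>\<close> is surjective with kernel the operadic ideal generated by \<open>R\<close>.\<close>

definition presented_by ::
  "('k::field, 'v::ab_group_add) operad_data \<Rightarrow> ('g \<Rightarrow> 'v) \<Rightarrow>
    (('g, nat) tree \<Rightarrow>\<^sub>0 'k) set \<Rightarrow> bool" where
  "presented_by P \<gamma> R \<longleftrightarrow>
     (\<exists>\<phi>. operad_morphism free_operad P \<phi> \<and>
        (\<forall>g. \<phi> (free_generator g) = \<gamma> g) \<and>
        (\<forall>A. label_set A \<longrightarrow>
           \<phi> ` component free_operad A = component P A \<and>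
           {x \<in> component free_operad A. \<phi> x = 0} = generated_ideal free_operad R A))"


section \<open>The operad of finite posets\<close>

text \<open>A poset is represented by its reflexive order relation \<open>r\<close>, with \<open>(x, y) \<in> r\<close> iff
  \<open>x \<le> y\<close>; its underlying set is \<open>Field r\<close>.\<close>

definition posets_on :: "'a set \<Rightarrow> 'a rel set" where
  "posets_on A = {r. finite A \<and> A \<noteq> {} \<and> partial_order_on A r}"

definition min_elems :: "'a rel \<Rightarrow> 'a set" where
  "min_elems r = {x \<in> Field r. underS r x = {}}"

definition poset_comp :: "'a \<Rightarrow> 'a rel \<Rightarrow> 'a rel \<Rightarrow> 'a rel" where
  "poset_comp a r s =
     s \<union> {(x, y) \<in> r. x \<noteq> a \<and> y \<noteq> a}
       \<union> {(x, y). x \<noteq> a \<and> (x, a) \<in> r \<and> y \<in> Field s}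
       \<union> {(x, y). x \<in> min_elems s \<and> y \<noteq> a \<and> (a, y) \<in> r}"

definition poset_operad :: "('k::field, nat rel \<Rightarrow>\<^sub>0 'k) operad_data" where
  "poset_operad =
     \<lparr>smult = scale,
      component = (\<lambda>A. {p. Poly_Mapping.keys p \<subseteq> posets_on A}),
      relabel = (\<lambda>\<sigma>. lin (\<lambda>r. map_prod \<sigma> \<sigma> ` r)),
      pcomp = (\<lambda>a. bilin (poset_comp a)),
      ounit = (\<lambda>a. basis {(a, a)})\<rparr>"


section \<open>Compatible posets\<close>

definition poset_triangle :: "'a rel \<Rightarrow> 'a rel \<Rightarrow> 'a rel"  (infixl \<open>\<triangledown>\<close> 65) where
  "r \<triangledown> s = r \<union> s \<union> min_elems s \<times> Field r"

text \<open>\<open>AboveS r (min_elems r)\<close> is the set of elements strictly above all minimal elements.\<close>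

definition b_part :: "'a rel \<Rightarrow> 'a rel" where
  "b_part r = r \<inter> AboveS r (min_elems r) \<times> AboveS r (min_elems r)"

definition r_part :: "'a rel \<Rightarrow> 'a rel" where
  "r_part r = r \<inter> (Field r - AboveS r (min_elems r)) \<times> (Field r - AboveS r (min_elems r))"

definition hasse :: "'a rel \<Rightarrow> 'a rel" where
  "hasse r = {(x, y) \<in> r. x \<noteq> y \<and> \<not> (\<exists>z. (x, z) \<in> r \<and> (z, y) \<in> r \<and> z \<noteq> x \<and> z \<noteq> y)}"

definition hasse_path :: "'a rel \<Rightarrow> 'a rel" where
  "hasse_path r = (hasse r \<union> (hasse r)\<inverse>)\<^sup>* \<inter> Field r \<times> Field r"

definition connected_poset :: "'a rel \<Rightarrow> bool" where
  "connected_poset r \<longleftrightarrow> hasse_path r = Field r \<times> Field r"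

definition poset_components :: "'a rel \<Rightarrow> 'a rel set" where
  "poset_components r = (\<lambda>C. r \<inter> C \<times> C) ` (Field r // hasse_path r)"

inductive compatible :: "'a rel \<Rightarrow> bool" where
  singleton: "compatible {(a, a)}"
| disconnected:
    "\<lbrakk>r \<in> posets_on A; card A \<ge> 2; \<not> connected_poset r;
      \<forall>s\<in>poset_components r. compatible s\<rbrakk> \<Longrightarrow> compatible r"
| connected:
    "\<lbrakk>r \<in> posets_on A; card A \<ge> 2; connected_poset r; b_part r \<noteq> {};
      compatible (b_part r); compatible (r_part r); r = b_part r \<triangledown> r_part r\<rbrakk>
      \<Longrightarrow> compatible r"

definition CP :: "nat set \<Rightarrow> (nat rel \<Rightarrow>\<^sub>0 'k::field) set" where
  "CP A = module.span scale (basis ` {r \<in> posets_on A. compatible r})"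

definition CP_operad :: "('k::field, nat rel \<Rightarrow>\<^sub>0 'k) operad_data" where
  "CP_operad = poset_operad\<lparr>component := CP\<rparr>"


section \<open>Generators and relations\<close>

datatype generator = Gen_m | Gen_triangle

primrec gen_poset :: "generator \<Rightarrow> nat rel" where
  "gen_poset Gen_m = {(1, 1), (2, 2)}"
| "gen_poset Gen_triangle = {(1, 1), (2, 2), (2, 1)}"

definition CP_relations :: "((generator, nat) tree \<Rightarrow>\<^sub>0 'k::field) set" where
  "CP_relations =
     (let m = free_generator Gen_m;
          t = free_generator Gen_triangle;
          comp = numbered_pcomp free_operad 2
      in {relabel free_operad (transpose 1 2) m - m,
          comp 1 m m - comp 2 m m,
          comp 1 t m - comp 2 t t})"

end

(* Send a binary tree decorated by m and the triangle to the poset obtained by reading m as disjoint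
   union and the triangle as the operation on posets. Grafting becomes poset_comp, so everything
   reduces to two facts about trees: the posets that occur are exactly the compatible ones, and two
   trees give the same poset iff they are related by the congruence generated by the relations.

   For the second fact, a poset determines a normal form of its trees. If the poset is disconnected,
   the root of a tree is m, and commutativity and associativity bring the component of any chosen
   label to the left. If it is connected, the root is a triangle, and the third relation, read from
   right to left, makes the right subtree not rooted at a triangle; then no element of the right
   poset lies above all its minimal elements, so the two subtrees give the b-part and the r-part. *)

theory Submission
  imports Defs "HOL-Library.Multiset"
begin

section \<open>Multilinear extension\<close>

text \<open>Evaluation maps basis elements to basis elements, so its kernel is spanned by
  differences of trees with equal values; this is why a congruence on trees decides a question about
  linear ideals. Two obstacles shape the rest. First, \<open>compatible\<close> prescribes the
  decomposition into b-part and r-part, so closure under the triangle is not immediate: if the lower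
  poset is itself \<open>b \<triangledown> q\<close> in this way, the parts of
  \<open>r \<triangledown> (b \<triangledown> q)\<close> are \<open>r \<union> b\<close> and
  \<open>q\<close>. The identity behind the third relation is therefore needed already for posets;
  it holds because \<open>b \<triangledown> q\<close> has the same minimal elements as
  \<open>q\<close>. Second, suboperads and ideals are closed under partial composition along
  disjoint label sets, not directly under forming nodes, so every node and every instance of a
  relation is obtained by grafting at fresh labels. The free operad imposes no symmetry on its
  generators, which is why commutativity of \<open>m\<close> is treated as a relation like the
  others.\<close>

interpretation scale: vector_space "scale :: 'k::field \<Rightarrow> ('b \<Rightarrow>\<^sub>0 'k) \<Rightarrow> _"
  by (rule vector_space_scale)

lemma lookup_basis: "Poly_Mapping.lookup (basis b) c = (if b = c then 1 else 0)"
  by (simp add: basis_def lookup_single when_def)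

lemma keys_basis [simp]: "Poly_Mapping.keys (basis b :: 'b \<Rightarrow>\<^sub>0 'k::field) = {b}"
  by (simp add: basis_def)

lemma keys_scale_subset: "Poly_Mapping.keys p \<subseteq> S \<Longrightarrow> Poly_Mapping.keys (scale c p) \<subseteq> S"
  by (auto simp: in_keys_iff lookup_scale)

lemma keys_add_subset:
  "\<lbrakk>Poly_Mapping.keys p \<subseteq> S; Poly_Mapping.keys q \<subseteq> S\<rbrakk> \<Longrightarrow> Poly_Mapping.keys (p + q) \<subseteq> S"
  using keys_add[of p q] by blast

lemma sum_keys_basis:
  "(\<Sum>b\<in>Poly_Mapping.keys p. scale (Poly_Mapping.lookup p b) (basis b)) = p"
  by (rule poly_mapping_eqI)
    (simp add: lookup_sum lookup_scale lookup_basis in_keys_iff if_distrib cong: if_cong)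

text \<open>Turns \<open>CP\<close>, which is defined as a span, into a condition on supports, the
  form in which the components of \<open>free_operad\<close> and \<open>poset_operad\<close> are
  given.\<close>

lemma span_basis: "scale.span (basis ` S :: ('b \<Rightarrow>\<^sub>0 'k::field) set) = {p. Poly_Mapping.keys p \<subseteq> S}"
proof
  have "scale.subspace {p :: 'b \<Rightarrow>\<^sub>0 'k. Poly_Mapping.keys p \<subseteq> S}"
    by (simp add: scale.subspace_def keys_add_subset keys_scale_subset)
  then show "scale.span (basis ` S) \<subseteq> {p :: 'b \<Rightarrow>\<^sub>0 'k. Poly_Mapping.keys p \<subseteq> S}"
    by (intro scale.span_minimal) auto
  have "(\<Sum>b\<in>Poly_Mapping.keys p. scale (Poly_Mapping.lookup p b) (basis b)) \<in> scale.span (basis ` S)"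
    if "Poly_Mapping.keys p \<subseteq> S" for p :: "'b \<Rightarrow>\<^sub>0 'k"
    using that by (intro scale.span_sum scale.span_scale scale.span_base) auto
  then show "{p :: 'b \<Rightarrow>\<^sub>0 'k. Poly_Mapping.keys p \<subseteq> S} \<subseteq> scale.span (basis ` S)"
    by (auto simp: sum_keys_basis)
qed

lemma subspace_keys_subset: "scale.subspace {p :: 'b \<Rightarrow>\<^sub>0 'k::field. Poly_Mapping.keys p \<subseteq> S}"
  by (metis span_basis scale.subspace_span)

text \<open>The tool for multilinear identities. The support condition is part of the predicate in
  the span induction, so the cases for sums and multiples may assume it.\<close>

lemma free_induct [consumes 1, case_names zero add scale basis]:
  fixes p :: "'b \<Rightarrow>\<^sub>0 'k::field"
  assumes "Poly_Mapping.keys p \<subseteq> S" and "Q 0"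
    and "\<And>x y. \<lbrakk>Poly_Mapping.keys x \<subseteq> S; Poly_Mapping.keys y \<subseteq> S; Q x; Q y\<rbrakk> \<Longrightarrow> Q (x + y)"
    and "\<And>c x. \<lbrakk>Poly_Mapping.keys x \<subseteq> S; Q x\<rbrakk> \<Longrightarrow> Q (scale c x)"
    and "\<And>b. b \<in> S \<Longrightarrow> Q (basis b)"
  shows "Q p"
proof -
  have "p \<in> scale.span (basis ` S)"
    using assms(1) by (simp add: span_basis)
  moreover have "scale.subspace {p. Poly_Mapping.keys p \<subseteq> S \<and> Q p}"
    using assms(2-4) subspace_keys_subset[of S] unfolding scale.subspace_def by blast
  ultimately show ?thesis
    using scale.span_induct[of p "basis ` S" "\<lambda>p. Poly_Mapping.keys p \<subseteq> S \<and> Q p"] assms(5)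
    by (metis (no_types, lifting) Collect_cong imageE keys_basis empty_subsetI insert_subset)
qed

text \<open>\<open>lin\<close> sums over the support, which varies with the argument; a common
  finite index set lets two such sums be compared term by term.\<close>

lemma lin_superset:
  assumes "finite K" "Poly_Mapping.keys p \<subseteq> K"
  shows "lin f p = (\<Sum>b\<in>K. scale (Poly_Mapping.lookup p b) (basis (f b)))"
  unfolding lin_def using assms
  by (intro sum.mono_neutral_left) (auto simp: in_keys_iff)

lemma lin_zero [simp]: "lin f 0 = 0"
  by (simp add: lin_def)

lemma lin_add: "lin f (p + q) = lin f p + lin f q"
proof -
  let ?K = "Poly_Mapping.keys p \<union> Poly_Mapping.keys q"
  have "finite ?K" "Poly_Mapping.keys (p + q) \<subseteq> ?K"
    by (simp_all add: keys_add)
  then show ?thesis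
    by (simp add: lin_superset[of ?K] lookup_add scale.scale_left_distrib sum.distrib)
qed

lemma lin_scale: "lin f (scale c p) = scale c (lin f p)"
  by (subst lin_superset[OF finite_keys keys_scale_subset[OF order_refl]])
    (simp add: lin_def lookup_scale scale.scale_sum_right)

lemma lin_basis [simp]: "lin f (basis b) = basis (f b)"
  by (simp add: lin_def lookup_basis)

lemma lin_diff: "lin f (p - q) = lin f p - lin f q"
  by (metis add_diff_cancel diff_add_cancel lin_add)

lemma bilin_basis_left [simp]: "bilin f (basis b) q = lin (f b) q"
  by (simp add: bilin_def lin_def lookup_basis)

lemma bilin_lin: "bilin f p q =
  (\<Sum>b\<in>Poly_Mapping.keys p. scale (Poly_Mapping.lookup p b) (lin (f b) q))"
  by (simp add: bilin_def lin_def scale.scale_sum_right)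

lemma bilin_superset:
  assumes "finite K" "Poly_Mapping.keys p \<subseteq> K"
  shows "bilin f p q = (\<Sum>b\<in>K. scale (Poly_Mapping.lookup p b) (lin (f b) q))"
  unfolding bilin_lin using assms
  by (intro sum.mono_neutral_left) (auto simp: in_keys_iff)

lemma bilin_zero [simp]: "bilin f 0 q = 0" "bilin f p 0 = 0"
  by (simp_all add: bilin_def)

lemma bilin_add_left: "bilin f (p + p') q = bilin f p q + bilin f p' q"
proof -
  let ?K = "Poly_Mapping.keys p \<union> Poly_Mapping.keys p'"
  have "finite ?K" "Poly_Mapping.keys (p + p') \<subseteq> ?K"
    by (simp_all add: keys_add)
  then show ?thesis
    by (simp add: bilin_superset[of ?K] lookup_add scale.scale_left_distrib sum.distrib)
qed

lemma bilin_scale_left: "bilin f (scale c p) q = scale c (bilin f p q)"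
  by (subst bilin_superset[OF finite_keys keys_scale_subset[OF order_refl]])
    (simp add: bilin_lin lookup_scale scale.scale_sum_right)

lemma bilin_add_right: "bilin f p (q + q') = bilin f p q + bilin f p q'"
  by (simp add: bilin_lin lin_add scale.scale_right_distrib sum.distrib)

lemma bilin_scale_right: "bilin f p (scale c q) = scale c (bilin f p q)"
  by (simp add: bilin_lin lin_scale scale.scale_sum_right mult.commute)

lemma bilin_diff_left: "bilin f (p - p') q = bilin f p q - bilin f p' q"
  by (metis add_diff_cancel diff_add_cancel bilin_add_left)

text \<open>With these rules the linear cases of \<open>free_induct\<close> close by simplification,
  leaving only the basis elements.\<close>

lemmas multilinear = lin_add lin_scale bilin_add_left bilin_add_right
  bilin_scale_left bilin_scale_right scale.scale_right_distrib

lemma keys_lin_subset: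
  assumes "Poly_Mapping.keys p \<subseteq> S" "f ` S \<subseteq> T"
  shows "Poly_Mapping.keys (lin f p) \<subseteq> T"
  using assms(1)
proof (induction rule: free_induct)
  case (add x y)
  then show ?case by (simp add: lin_add keys_add_subset)
next
  case (scale c x)
  then show ?case by (simp add: lin_scale keys_scale_subset)
qed (use assms(2) in auto)

lemma keys_bilin_subset:
  assumes "Poly_Mapping.keys p \<subseteq> S" "Poly_Mapping.keys q \<subseteq> T"
    and "\<And>b c. \<lbrakk>b \<in> S; c \<in> T\<rbrakk> \<Longrightarrow> f b c \<in> U"
  shows "Poly_Mapping.keys (bilin f p q) \<subseteq> U"
  using assms(1)
proof (induction rule: free_induct)
  case (add x y)
  then show ?case by (simp add: bilin_add_left keys_add_subset)
next
  case (scale c x)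
  then show ?case by (simp add: bilin_scale_left keys_scale_subset)
next
  case (basis b)
  then show ?case using assms(3) by (auto intro!: keys_lin_subset[OF assms(2)])
qed auto

lemma lin_cong:
  assumes "Poly_Mapping.keys p \<subseteq> S" "\<And>b. b \<in> S \<Longrightarrow> f b = g b"
  shows "lin f p = lin g p"
  using assms by (auto simp: lin_def intro!: sum.cong)

lemma lin_lin: "lin f (lin g p) = lin (\<lambda>x. f (g x)) p"
  using subset_UNIV[of "Poly_Mapping.keys p"]
  by (induction rule: free_induct) (simp_all add: multilinear)

lemma lin_id:
  assumes "Poly_Mapping.keys p \<subseteq> S" "\<And>b. b \<in> S \<Longrightarrow> f b = b"
  shows "lin f p = p"
  using assms by (induction rule: free_induct) (simp_all add: multilinear)

section \<open>The operad of posets\<close>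

lemma posets_onD:
  assumes "r \<in> posets_on A"
  shows "finite A" "A \<noteq> {}" "\<And>x. (x, x) \<in> r \<longleftrightarrow> x \<in> A" "\<And>x y. (x, y) \<in> r \<Longrightarrow> x \<in> A"
    "\<And>x y. (x, y) \<in> r \<Longrightarrow> y \<in> A" "\<And>x y. \<lbrakk>(x, y) \<in> r; (y, x) \<in> r\<rbrakk> \<Longrightarrow> x = y"
    "\<And>x y z. \<lbrakk>(x, y) \<in> r; (y, z) \<in> r\<rbrakk> \<Longrightarrow> (x, z) \<in> r"
  using assms by (auto simp: posets_on_def order_on_defs refl_on_def antisym_def dest: transD)

lemma posets_on_subset: "r \<in> posets_on A \<Longrightarrow> r \<subseteq> A \<times> A"
  using posets_onD(4,5)[of r A] by auto

lemma Field_posets_on: "r \<in> posets_on A \<Longrightarrow> Field r = A"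
  using posets_onD(3-5)[of r A] by (auto simp: Field_def)

lemma posets_onI:
  assumes "finite A" "A \<noteq> {}" "\<And>x. x \<in> A \<Longrightarrow> (x, x) \<in> r" "\<And>x y. (x, y) \<in> r \<Longrightarrow> x \<in> A \<and> y \<in> A"
    and "\<And>x y. \<lbrakk>(x, y) \<in> r; (y, x) \<in> r\<rbrakk> \<Longrightarrow> x = y"
    and "\<And>x y z. \<lbrakk>(x, y) \<in> r; (y, z) \<in> r\<rbrakk> \<Longrightarrow> (x, z) \<in> r"
  shows "r \<in> posets_on A"
proof -
  have "r \<subseteq> A \<times> A" using assms(4) by auto
  moreover have "trans r" using assms(6) by (rule transI)
  moreover have "antisym r" using assms(5) by (rule antisymI)
  ultimately show ?thesis
    using assms(1-3) by (simp add: posets_on_def order_on_defs refl_on_def)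
qed

lemma min_elems_iff:
  assumes "r \<in> posets_on A"
  shows "x \<in> min_elems r \<longleftrightarrow> x \<in> A \<and> (\<forall>y. (y, x) \<in> r \<longrightarrow> y = x)"
  by (auto simp: min_elems_def underS_def Field_posets_on[OF assms])

text \<open>Finiteness makes the descent stop: a strictly smaller element has a strictly smaller
  down-set.\<close>

lemma ex_min_elem_below:
  assumes r: "r \<in> posets_on A" and "x \<in> A"
  shows "\<exists>m\<in>min_elems r. (m, x) \<in> r"
  using \<open>x \<in> A\<close>
proof (induction "card {y. (y, x) \<in> r}" arbitrary: x rule: less_induct)
  case less
  show ?case
  proof (cases "x \<in> min_elems r")
    case True
    then show ?thesis using posets_onD(3)[OF r] less.prems by blast
  next
    case False
    then obtain y where y: "(y, x) \<in> r" "y \<noteq> x"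
      using less.prems by (auto simp: min_elems_iff[OF r])
    have fin: "finite {y. (y, x) \<in> r}"
      by (rule finite_subset[of _ A]) (use posets_onD[OF r] in auto)
    have sub: "{z. (z, y) \<in> r} \<subset> {z. (z, x) \<in> r}"
      using y posets_onD[OF r] less.prems by blast
    obtain m where "m \<in> min_elems r" "(m, y) \<in> r"
      using less.hyps[OF psubset_card_mono[OF fin sub]] posets_onD(4)[OF r y(1)] by blast
    then show ?thesis using posets_onD(7)[OF r _ y(1)] by blast
  qed
qed

lemma poset_comp_iff:
  assumes "s \<in> posets_on B"
  shows "(x, y) \<in> poset_comp a r s \<longleftrightarrow> (x, y) \<in> s \<or> (x, y) \<in> r \<and> x \<noteq> a \<and> y \<noteq> a
    \<or> x \<noteq> a \<and> (x, a) \<in> r \<and> y \<in> B \<or> x \<in> min_elems s \<and> y \<noteq> a \<and> (a, y) \<in> r"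
  by (auto simp: poset_comp_def Field_posets_on[OF assms])

text \<open>The fourth clause of \<open>poset_comp\<close> starts from minimal elements of
  \<open>s\<close> only, yet transitivity survives: if \<open>x\<close> lies below a minimal
  \<open>y\<close> in \<open>s\<close>, then \<open>x = y\<close>, so a step from \<open>s\<close>
  into \<open>r\<close> is never preceded by a proper step inside \<open>s\<close>.\<close>

lemma poset_comp_closed:
  assumes r: "r \<in> posets_on A" and s: "s \<in> posets_on B" and AB: "A \<inter> B = {}" and a: "a \<in> A"
  shows "poset_comp a r s \<in> posets_on ((A - {a}) \<union> B)"
proof (rule posets_onI)
  note i = poset_comp_iff[OF s] and m = min_elems_iff[OF s]
  note R = posets_onD[OF r] and S = posets_onD[OF s]
  have mB: "x \<in> B" if "x \<in> min_elems s" for x using that m by blast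
  have mE: "y = x" if "x \<in> min_elems s" "(y, x) \<in> s" for x y using that m by blast
  have AB': "x \<notin> B" if "x \<in> A" for x using that AB by blast
  show "finite (A - {a} \<union> B)" "A - {a} \<union> B \<noteq> {}" using R(1) S(1,2) by auto
  show "(x, x) \<in> poset_comp a r s" if "x \<in> A - {a} \<union> B" for x
    using that R(3) S(3) by (auto simp: i)
  show "x \<in> A - {a} \<union> B \<and> y \<in> A - {a} \<union> B" if "(x, y) \<in> poset_comp a r s" for x y
    using that R(4,5) S(4,5) by (auto simp: i m)
  show "x = y" if "(x, y) \<in> poset_comp a r s" "(y, x) \<in> poset_comp a r s" for x y
    using that unfolding i by (elim disjE conjE; metis R(4-6) S(4-6) R(7) mB mE AB')
  show "(x, z) \<in> poset_comp a r s" if "(x, y) \<in> poset_comp a r s" "(y, z) \<in> poset_comp a r s" for x y z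
    using that unfolding i by (elim disjE conjE; metis R(4-7) S(4-7) mB mE AB')
qed

text \<open>Needed when a composite is itself inserted, because the inserted poset is attached by
  its minimal elements. If \<open>a\<close> is not minimal, something lies strictly below it and
  hence below all of \<open>s\<close>.\<close>

lemma min_elems_poset_comp:
  assumes r: "r \<in> posets_on A" and s: "s \<in> posets_on B" and AB: "A \<inter> B = {}" and a: "a \<in> A"
  shows "min_elems (poset_comp a r s)
    = (if a \<in> min_elems r then (min_elems r - {a}) \<union> min_elems s else min_elems r)"
proof -
  note i = poset_comp_iff[OF s] and m = min_elems_iff[OF s]
  note R = posets_onD[OF r] and S = posets_onD[OF s]
  note M = min_elems_iff[OF poset_comp_closed[OF assms]]
  have B: "x \<in> min_elems (poset_comp a r s) \<longleftrightarrow> a \<in> min_elems r \<and> x \<in> min_elems s" if "x \<in> B" for x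
  proof
    have "x \<notin> A" using that AB by auto
    assume x: "x \<in> min_elems (poset_comp a r s)"
    have "y = a" if "(y, a) \<in> r" for y
      using x that \<open>x \<in> B\<close> \<open>x \<notin> A\<close> R(4) unfolding M i by metis
    moreover have "y = x" if "(y, x) \<in> s" for y
      using x that unfolding M i by metis
    ultimately show "a \<in> min_elems r \<and> x \<in> min_elems s"
      using \<open>x \<in> B\<close> a by (simp add: m min_elems_iff[OF r])
  next
    have "x \<notin> A" using that AB by auto
    assume "a \<in> min_elems r \<and> x \<in> min_elems s"
    then show "x \<in> min_elems (poset_comp a r s)"
      using \<open>x \<in> B\<close> \<open>x \<notin> A\<close> R(5) unfolding M i m min_elems_iff[OF r] by blast
  qed
  \<comment> \<open>A minimal element of \<open>s\<close> lies below every \<open>x\<close> strictly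
    above \<open>a\<close>, so it witnesses that such an \<open>x\<close> is not minimal in the
    composite.\<close>
  obtain b where b: "b \<in> min_elems s" using S(2) ex_min_elem_below[OF s] by blast
  then have "b \<in> B" by (simp add: m)
  have A: "x \<in> min_elems (poset_comp a r s) \<longleftrightarrow> x \<noteq> a \<and> x \<in> min_elems r" if "x \<in> A" for x
  proof -
    have "x \<notin> B" using that AB by auto
    then have x: "x \<noteq> b" using \<open>b \<in> B\<close> by auto
    show ?thesis
    proof
      assume "x \<in> min_elems (poset_comp a r s)"
      then show "x \<noteq> a \<and> x \<in> min_elems r"
        unfolding M i min_elems_iff[OF r] using \<open>x \<notin> B\<close> b x by (metis DiffE UnE singletonI)
    next
      assume "x \<noteq> a \<and> x \<in> min_elems r"
      then show "x \<in> min_elems (poset_comp a r s)"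
        unfolding M i min_elems_iff[OF r] using \<open>x \<notin> B\<close> S(5) by auto
    qed
  qed
  have "min_elems (poset_comp a r s) \<subseteq> A \<union> B" "min_elems r \<subseteq> A" "min_elems s \<subseteq> B"
    by (auto simp: M m min_elems_iff[OF r])
  then show ?thesis
    using A B AB by (auto split: if_splits)
qed

text \<open>The right side inserts a composite, so the minimal elements of that composite enter.
  Once they are known and disjointness has removed the impossible cases, both sides are the same
  combination of relations in \<open>r\<close>, \<open>s\<close> and \<open>t\<close>.\<close>

lemma poset_comp_sequential:
  assumes r: "r \<in> posets_on A" and s: "s \<in> posets_on B" and t: "t \<in> posets_on C"
    and d: "A \<inter> B = {}" "A \<inter> C = {}" "B \<inter> C = {}" and a: "a \<in> A" and b: "b \<in> B"
  shows "poset_comp b (poset_comp a r s) t = poset_comp a r (poset_comp b s t)"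
proof -
  note st = poset_comp_closed[OF s t d(3) b]
  note R = posets_onD[OF r] and S = posets_onD[OF s] and T = posets_onD[OF t]
  have "a \<noteq> b" "a \<notin> C" "b \<notin> A" "a \<notin> B" "b \<notin> C" using a b d by auto
  then have not: "a \<notin> B" "a \<notin> C" "b \<notin> A" "b \<notin> C" "a \<noteq> b" "a \<notin> min_elems s" "a \<notin> min_elems t"
    "\<And>u. (u, b) \<notin> r" "\<And>u. (b, u) \<notin> r" "\<And>u. (u, a) \<notin> s" "\<And>u. (a, u) \<notin> s"
    "\<And>u. (u, a) \<notin> t" "\<And>u. (a, u) \<notin> t" "b \<notin> min_elems t"
    using R(4,5) S(4,5) T(4,5) min_elems_iff[OF s] min_elems_iff[OF t] by blast+
  show ?thesis
    unfolding set_eq_iff split_paired_All poset_comp_iff[OF t] poset_comp_iff[OF s]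
      poset_comp_iff[OF st] min_elems_poset_comp[OF s t d(3) b]
    using not b by (simp add: not_sym[OF not(5)]) blast
qed

text \<open>Only \<open>s\<close> and \<open>t\<close> are inserted, so no minimal elements of a
  composite occur; elements of \<open>s\<close> and \<open>t\<close> become related to each other
  through \<open>a\<close> and \<open>a'\<close> in \<open>r\<close>.\<close>

lemma poset_comp_parallel:
  assumes r: "r \<in> posets_on A" and s: "s \<in> posets_on B" and t: "t \<in> posets_on C"
    and d: "A \<inter> B = {}" "A \<inter> C = {}" "B \<inter> C = {}" and a: "a \<in> A" and a': "a' \<in> A" "a \<noteq> a'"
  shows "poset_comp a' (poset_comp a r s) t = poset_comp a (poset_comp a' r t) s"
proof -
  note R = posets_onD[OF r] and S = posets_onD[OF s] and T = posets_onD[OF t]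
  have "a \<notin> B" "a \<notin> C" "a' \<notin> B" "a' \<notin> C" using a a' d by auto
  then have not: "a' \<notin> B" "a \<notin> C" "a' \<notin> min_elems s" "a \<notin> min_elems t"
    "\<And>u. (u, a') \<notin> s" "\<And>u. (a', u) \<notin> s" "\<And>u. (u, a) \<notin> t" "\<And>u. (a, u) \<notin> t"
    using S(4,5) T(4,5) min_elems_iff[OF s] min_elems_iff[OF t] by blast+
  show ?thesis
    unfolding set_eq_iff split_paired_All poset_comp_iff[OF t] poset_comp_iff[OF s]
    using not a' by (simp add: not_sym[OF a'(2)]) blast
qed

lemma in_map_prod_image:
  "(x, y) \<in> map_prod f f ` r \<longleftrightarrow> (\<exists>u v. (u, v) \<in> r \<and> x = f u \<and> y = f v)"
  by force

lemma posets_on_relabel: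
  assumes r: "r \<in> posets_on A" and \<sigma>: "bij_betw \<sigma> A B"
  shows "map_prod \<sigma> \<sigma> ` r \<in> posets_on B"
proof -
  note R = posets_onD[OF r]
  have B: "B = \<sigma> ` A" and inj: "inj_on \<sigma> A" using \<sigma> by (auto simp: bij_betw_def)
  have e: "x = y" if "\<sigma> x = \<sigma> y" "x \<in> A" "y \<in> A" for x y
    using that inj by (auto dest: inj_onD)
  have ax: "x \<in> A \<and> y \<in> A" if "(x, y) \<in> r" for x y using R(4,5) that by blast
  show ?thesis
    unfolding B
  proof (rule posets_onI)
    show "(x, z) \<in> map_prod \<sigma> \<sigma> ` r"
      if xy: "(x, y) \<in> map_prod \<sigma> \<sigma> ` r" and yz: "(y, z) \<in> map_prod \<sigma> \<sigma> ` r" for x y z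
    proof -
      obtain u v v' w where "(u, v) \<in> r" "(v', w) \<in> r" "\<sigma> v = \<sigma> v'" "x = \<sigma> u" "z = \<sigma> w"
        using xy yz by (auto simp: in_map_prod_image)
      moreover have "v = v'" using calculation e ax by blast
      ultimately show ?thesis using R(7)[of u v w] by (auto simp: in_map_prod_image)
    qed
    show "x = y" if xy: "(x, y) \<in> map_prod \<sigma> \<sigma> ` r" and yx: "(y, x) \<in> map_prod \<sigma> \<sigma> ` r" for x y
    proof -
      obtain u v v' w where "(u, v) \<in> r" "(v', w) \<in> r" "\<sigma> v = \<sigma> v'" "\<sigma> u = \<sigma> w" "x = \<sigma> u" "y = \<sigma> v"
        using xy yx by (auto simp: in_map_prod_image)
      moreover have "v = v'" "u = w" using calculation e ax by blast+
      ultimately show ?thesis using R(6) by force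
    qed
    show "(y, y) \<in> map_prod \<sigma> \<sigma> ` r" if "y \<in> \<sigma> ` A" for y
      using that R(3) unfolding in_map_prod_image by blast
  qed (use R(1,2) ax in \<open>auto simp: in_map_prod_image\<close>)
qed

text \<open>\<open>\<sigma>\<close> stands for an injection on \<open>A\<close> and may collapse
  points elsewhere, hence the membership conditions.\<close>

lemma map_prod_image_iff:
  assumes r: "r \<subseteq> A \<times> A" and \<sigma>: "inj_on \<sigma> A" and x: "x \<in> A" "y \<in> A"
  shows "(\<sigma> x, \<sigma> y) \<in> map_prod \<sigma> \<sigma> ` r \<longleftrightarrow> (x, y) \<in> r"
  using x inj_onD[OF \<sigma>] r unfolding in_map_prod_image by (metis SigmaE2 subsetD)

lemma min_elems_relabel:
  assumes r: "r \<in> posets_on A" and \<sigma>: "bij_betw \<sigma> A B"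
  shows "min_elems (map_prod \<sigma> \<sigma> ` r) = \<sigma> ` min_elems r"
proof -
  have B: "B = \<sigma> ` A" and inj: "inj_on \<sigma> A" using \<sigma> by (auto simp: bij_betw_def)
  have iff: "\<sigma> x \<in> min_elems (map_prod \<sigma> \<sigma> ` r) \<longleftrightarrow> x \<in> min_elems r" if "x \<in> A" for x
  proof -
    have "\<sigma> x \<in> min_elems (map_prod \<sigma> \<sigma> ` r) \<longleftrightarrow> (\<forall>y\<in>A. (y, x) \<in> r \<longrightarrow> y = x)"
    proof -
      have "\<sigma> x \<in> min_elems (map_prod \<sigma> \<sigma> ` r)
          \<longleftrightarrow> (\<forall>y\<in>\<sigma> ` A. (y, \<sigma> x) \<in> map_prod \<sigma> \<sigma> ` r \<longrightarrow> y = \<sigma> x)"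
        using that unfolding min_elems_iff[OF posets_on_relabel[OF r \<sigma>]] B
        by (metis B imageI posets_onD(4)[OF posets_on_relabel[OF r \<sigma>]])
      also have "\<dots> \<longleftrightarrow> (\<forall>y\<in>A. (y, x) \<in> r \<longrightarrow> y = x)"
        using that inj_onD[OF inj] by (auto simp: map_prod_image_iff[OF posets_on_subset[OF r] inj])
      finally show ?thesis .
    qed
    then show ?thesis using that posets_onD(4)[OF r] by (auto simp: min_elems_iff[OF r])
  qed
  show ?thesis
  proof
    show "min_elems (map_prod \<sigma> \<sigma> ` r) \<subseteq> \<sigma> ` min_elems r"
      using iff B by (auto simp: min_elems_iff[OF posets_on_relabel[OF r \<sigma>]])
    show "\<sigma> ` min_elems r \<subseteq> min_elems (map_prod \<sigma> \<sigma> ` r)"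
      using iff by (auto simp: min_elems_iff[OF r])
  qed
qed

lemma rel_eq_on_image:
  assumes "r \<subseteq> f ` D \<times> f ` D" "s \<subseteq> f ` D \<times> f ` D"
    and "\<And>x y. \<lbrakk>x \<in> D; y \<in> D\<rbrakk> \<Longrightarrow> (f x, f y) \<in> r \<longleftrightarrow> (f x, f y) \<in> s"
  shows "r = s"
  using assms by (intro subset_antisym subrelI) blast+

text \<open>Since \<open>A'\<close> and \<open>B'\<close> are disjoint, \<open>\<sigma>\<close> and
  \<open>\<tau>\<close> merge into one map \<open>\<rho>\<close> that is injective on all of
  \<open>A \<union> B\<close>, including the label \<open>a\<close> that disappears. Each ingredient
  of \<open>poset_comp\<close> is then transported by an equivalence.\<close>

lemma poset_comp_relabel:
  assumes r: "r \<in> posets_on A" and s: "s \<in> posets_on B" and AB: "A \<inter> B = {}" and a: "a \<in> A"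
    and \<sigma>: "bij_betw \<sigma> A A'" and \<tau>: "bij_betw \<tau> B B'" and AB': "A' \<inter> B' = {}"
  defines "\<rho> \<equiv> \<lambda>i. if i \<in> B then \<tau> i else \<sigma> i"
  shows "poset_comp (\<sigma> a) (map_prod \<sigma> \<sigma> ` r) (map_prod \<tau> \<tau> ` s)
    = map_prod \<rho> \<rho> ` poset_comp a r s"
proof -
  note r' = posets_on_relabel[OF r \<sigma>] and s' = posets_on_relabel[OF s \<tau>]
  have \<rho>A: "\<rho> x = \<sigma> x" if "x \<in> A" for x using that AB by (auto simp: \<rho>_def)
  have \<rho>B: "\<rho> x = \<tau> x" if "x \<in> B" for x using that by (auto simp: \<rho>_def)
  have injA: "inj_on \<rho> A" using \<sigma> \<rho>A by (simp add: bij_betw_def inj_on_def)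
  have injB: "inj_on \<rho> B" using \<tau> \<rho>B by (simp add: bij_betw_def inj_on_def)
  have A': "A' = \<rho> ` A" and B': "B' = \<rho> ` B" using \<sigma> \<tau> \<rho>A \<rho>B by (auto simp: bij_betw_def)
  have inj: "inj_on \<rho> (A \<union> B)"
    using AB' unfolding A' B' inj_on_Un by (simp add: injA injB) blast
  have mr: "map_prod \<sigma> \<sigma> ` r = map_prod \<rho> \<rho> ` r"
    by (rule image_cong[OF refl]) (use posets_on_subset[OF r] \<rho>A in auto)
  have ms: "map_prod \<tau> \<tau> ` s = map_prod \<rho> \<rho> ` s"
    by (rule image_cong[OF refl]) (use posets_on_subset[OF s] \<rho>B in auto)
  have bA: "bij_betw \<rho> A A'" and bB: "bij_betw \<rho> B B'"
    using injA injB A' B' by (auto simp: bij_betw_def)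
  have ne: "\<rho> x \<noteq> \<rho> y" if "x \<in> A" "y \<in> B" for x y
    using that inj AB by (metis UnI1 UnI2 disjoint_iff inj_onD)
  let ?L = "poset_comp (\<rho> a) (map_prod \<rho> \<rho> ` r) (map_prod \<rho> \<rho> ` s)"
  have closed: "?L \<in> posets_on ((A' - {\<rho> a}) \<union> B')"
    using poset_comp_closed[OF r'[unfolded mr] s'[unfolded ms] AB'] a A' by auto
  have inj': "inj_on \<rho> ((A - {a}) \<union> B)" using inj by (rule inj_on_subset) auto
  have img: "(A' - {\<rho> a}) \<union> B' = \<rho> ` ((A - {a}) \<union> B)"
    unfolding A' B' using a inj_on_image_set_diff[OF injA, of A "{a}"] by (simp add: image_Un)
  have bij: "bij_betw \<rho> ((A - {a}) \<union> B) ((A' - {\<rho> a}) \<union> B')"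
    using inj' img by (simp add: bij_betw_def)
  note c = poset_comp_closed[OF r s AB a]
  have key: "(\<rho> x, \<rho> y) \<in> ?L \<longleftrightarrow> (\<rho> x, \<rho> y) \<in> map_prod \<rho> \<rho> ` poset_comp a r s"
    if "x \<in> (A - {a}) \<union> B" "y \<in> (A - {a}) \<union> B" for x y
  proof -
    have S: "(\<rho> u, \<rho> v) \<in> map_prod \<rho> \<rho> ` s \<longleftrightarrow> (u, v) \<in> s" if "u \<in> A \<union> B" "v \<in> A \<union> B" for u v
      using that posets_on_subset[OF s] by (intro map_prod_image_iff[OF _ inj]) auto
    have R: "(\<rho> u, \<rho> v) \<in> map_prod \<rho> \<rho> ` r \<longleftrightarrow> (u, v) \<in> r" if "u \<in> A \<union> B" "v \<in> A \<union> B" for u v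
      using that posets_on_subset[OF r] by (intro map_prod_image_iff[OF _ inj]) auto
    have M: "\<rho> u \<in> min_elems (map_prod \<rho> \<rho> ` s) \<longleftrightarrow> u \<in> min_elems s" if "u \<in> A \<union> B" for u
      using that min_elems_iff[OF s]
      by (auto simp: min_elems_relabel[OF s bB] inj_on_image_mem_iff[OF inj] subset_iff)
    have F: "\<rho> u \<in> B' \<longleftrightarrow> u \<in> B" if "u \<in> A \<union> B" for u
      using that ne B' by auto
    have E: "\<rho> u = \<rho> a \<longleftrightarrow> u = a" if "u \<in> A \<union> B" for u
      using that inj a by (simp add: inj_on_eq_iff)
    have "x \<in> A \<union> B" "y \<in> A \<union> B" "a \<in> A \<union> B" using that a by auto
    then show ?thesis
      by (simp add: map_prod_image_iff[OF posets_on_subset[OF c] inj' that] poset_comp_iff[OF s'[unfolded ms]]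
          poset_comp_iff[OF s] S R M F E)
  qed
  have "?L \<subseteq> \<rho> ` ((A - {a}) \<union> B) \<times> \<rho> ` ((A - {a}) \<union> B)"
    using posets_on_subset[OF closed] unfolding img .
  moreover have "map_prod \<rho> \<rho> ` poset_comp a r s \<subseteq> \<rho> ` ((A - {a}) \<union> B) \<times> \<rho> ` ((A - {a}) \<union> B)"
    using posets_on_subset[OF posets_on_relabel[OF c bij]] unfolding img .
  ultimately have "?L = map_prod \<rho> \<rho> ` poset_comp a r s"
    using key by (rule rel_eq_on_image)
  then show ?thesis using mr ms \<rho>A[OF a] by simp
qed

lemma singleton_poset: "{(a, a)} \<in> posets_on {a}"
  by (rule posets_onI) auto

lemma min_elems_singleton: "min_elems {(a, a)} = {a}"
  using min_elems_iff[OF singleton_poset[of a]] by auto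

lemma poset_operad_sel [simp]:
  "smult poset_operad = scale"
  "component poset_operad = (\<lambda>A. {p. Poly_Mapping.keys p \<subseteq> posets_on A})"
  "relabel poset_operad = (\<lambda>\<sigma>. lin (\<lambda>r. map_prod \<sigma> \<sigma> ` r))"
  "pcomp poset_operad = (\<lambda>a. bilin (poset_comp a))"
  "ounit poset_operad = (\<lambda>a. basis {(a, a)})"
  by (simp_all add: poset_operad_def)

text \<open>The axioms are closure statements or multilinear identities, so induction on each
  argument leaves the facts about single posets proved above.\<close>

lemma operad_poset_operad: "operad (poset_operad :: ('k::field, nat rel \<Rightarrow>\<^sub>0 'k) operad_data)"
proof -
  have bilin_closed: "Poly_Mapping.keys (bilin (poset_comp a) x y) \<subseteq> posets_on ((A - {a}) \<union> B)"
    if "A \<inter> B = {}" "a \<in> A" "Poly_Mapping.keys x \<subseteq> posets_on A" "Poly_Mapping.keys y \<subseteq> posets_on B"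
    for A B a and x y :: "nat rel \<Rightarrow>\<^sub>0 'k"
    using that by (intro keys_bilin_subset[OF that(3,4)] poset_comp_closed)
  have equivariant: "bilin (poset_comp (\<sigma> a)) (lin (\<lambda>r. map_prod \<sigma> \<sigma> ` r) x) (lin (\<lambda>r. map_prod \<tau> \<tau> ` r) y)
      = lin (\<lambda>r. map_prod (\<lambda>i. if i \<in> B then \<tau> i else \<sigma> i) (\<lambda>i. if i \<in> B then \<tau> i else \<sigma> i) ` r)
          (bilin (poset_comp a) x y)"
    if "A \<inter> B = {}" "a \<in> A" "bij_betw \<sigma> A A'" "bij_betw \<tau> B B'" "A' \<inter> B' = {}"
      and x: "Poly_Mapping.keys x \<subseteq> posets_on A" and y: "Poly_Mapping.keys y \<subseteq> posets_on B"
    for A B A' B' a \<sigma> \<tau> and x y :: "nat rel \<Rightarrow>\<^sub>0 'k"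
    using x
  proof (induction x rule: free_induct)
    case (basis r)
    from y show ?case
    proof (induction y rule: free_induct)
      case (basis s)
      then show ?case
        using poset_comp_relabel[OF \<open>r \<in> posets_on A\<close> basis that(1-5)] by simp
    qed (simp_all add: multilinear del: bilin_basis_left)
  qed (simp_all add: multilinear)
  have sequential: "bilin (poset_comp b) (bilin (poset_comp a) x y) z
      = bilin (poset_comp a) x (bilin (poset_comp b) y z)"
    if d: "A \<inter> B = {}" "A \<inter> C = {}" "B \<inter> C = {}" "a \<in> A" "b \<in> B"
      and x: "Poly_Mapping.keys x \<subseteq> posets_on A" and y: "Poly_Mapping.keys y \<subseteq> posets_on B"
      and z: "Poly_Mapping.keys z \<subseteq> posets_on C"
    for A B C a b and x y z :: "nat rel \<Rightarrow>\<^sub>0 'k"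
    using x
  proof (induction x rule: free_induct)
    case (basis r)
    note r = basis
    from y show ?case
    proof (induction y rule: free_induct)
      case (basis s)
      note s = basis
      from z show ?case
      proof (induction z rule: free_induct)
        case (basis t)
        show ?case
          using poset_comp_sequential[OF r s basis d] by simp
      qed (simp_all add: multilinear)
    qed (simp_all add: multilinear)
  qed (simp_all add: multilinear)
  have parallel: "bilin (poset_comp a') (bilin (poset_comp a) x y) z
      = bilin (poset_comp a) (bilin (poset_comp a') x z) y"
    if d: "A \<inter> B = {}" "A \<inter> C = {}" "B \<inter> C = {}" "a \<in> A" "a' \<in> A" "a \<noteq> a'"
      and x: "Poly_Mapping.keys x \<subseteq> posets_on A" and y: "Poly_Mapping.keys y \<subseteq> posets_on B"
      and z: "Poly_Mapping.keys z \<subseteq> posets_on C"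
    for A B C a a' and x y z :: "nat rel \<Rightarrow>\<^sub>0 'k"
    using x
  proof (induction x rule: free_induct)
    case (basis r)
    note r = basis
    from y show ?case
    proof (induction y rule: free_induct)
      case (basis s)
      note s = basis
      from z show ?case
      proof (induction z rule: free_induct)
        case (basis t)
        show ?case
          using poset_comp_parallel[OF r s basis d] by simp
      qed (simp_all add: multilinear)
    qed (simp_all add: multilinear)
  qed (simp_all add: multilinear)
  have unit_left: "bilin (poset_comp a) (basis {(a, a)}) y = y"
    if "a \<notin> B" "Poly_Mapping.keys y \<subseteq> posets_on B" for a B and y :: "nat rel \<Rightarrow>\<^sub>0 'k"
    unfolding bilin_basis_left
    by (rule lin_id[OF that(2)]) (auto simp: poset_comp_def)
  have unit_right: "bilin (poset_comp a) x (basis {(b, b)})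
      = lin (\<lambda>r. map_prod (id(a := b)) (id(a := b)) ` r) x"
    if "a \<in> A" "b \<notin> A" "Poly_Mapping.keys x \<subseteq> posets_on A" for a b A and x :: "nat rel \<Rightarrow>\<^sub>0 'k"
    using that(3)
  proof (induction x rule: free_induct)
    case (basis r)
    have "poset_comp a r {(b, b)} = map_prod (id(a := b)) (id(a := b)) ` r"
      unfolding set_eq_iff split_paired_All poset_comp_iff[OF singleton_poset] min_elems_singleton in_map_prod_image
      using posets_onD(3-5)[OF basis] that(1,2) by (auto simp: fun_upd_def)
    then show ?case by (simp only: bilin_basis_left lin_basis)
  qed (simp_all add: multilinear)
  show ?thesis
    \<comment> \<open>The subgoals come in the order in which \<open>operad\<close> lists its
      assumptions.\<close>
    apply (intro operad.intro operad_axioms.intro)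
    apply (unfold poset_operad_sel mem_Collect_eq)
    subgoal by (rule vector_space_scale)
    subgoal by (rule subspace_keys_subset)
    subgoal by (intro keys_lin_subset image_subsetI posets_on_relabel)
    subgoal by (simp only: multilinear)
    subgoal by (simp only: multilinear)
    subgoal by (rule lin_cong, assumption, rule image_cong[OF refl]) (use posets_on_subset in fastforce)
    subgoal by (rule lin_id) (auto simp: map_prod.id)
    subgoal by (simp add: lin_lin image_comp map_prod.comp)
    subgoal by (rule bilin_closed)
    subgoal by (simp only: multilinear)
    subgoal by (simp only: multilinear)
    subgoal by (simp only: multilinear)
    subgoal by (simp only: multilinear)
    subgoal by (rule equivariant)
    subgoal by (rule sequential)
    subgoal by (rule parallel)
    subgoal by (simp add: singleton_poset)
    subgoal by simp
    subgoal by (rule unit_left)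
    subgoal by (rule unit_right)
    done
qed

section \<open>Posets built from trees\<close>

text \<open>The right subtree is the lower part of a triangle: its minimal elements go below the
  left subtree, which gives the chain \<open>2 < 1\<close> for the leaves \<open>1\<close>,
  \<open>2\<close>.\<close>

primrec eval_tree :: "(generator, 'a) tree \<Rightarrow> 'a rel" where
  "eval_tree (Leaf a) = {(a, a)}"
| "eval_tree (Node g s t) =
    (case g of Gen_m \<Rightarrow> eval_tree s \<union> eval_tree t | Gen_triangle \<Rightarrow> eval_tree s \<triangledown> eval_tree t)"

lemma posets_on_union:
  assumes r: "r \<in> posets_on A" and s: "s \<in> posets_on B" and AB: "A \<inter> B = {}"
  shows "r \<union> s \<in> posets_on (A \<union> B)"
proof (rule posets_onI)
  note R = posets_onD[OF r] and S = posets_onD[OF s]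
  have AB': "x \<notin> B" if "x \<in> A" for x using that AB by blast
  show "finite (A \<union> B)" "A \<union> B \<noteq> {}" using R(1,2) S(1) by auto
  show "(x, x) \<in> r \<union> s" if "x \<in> A \<union> B" for x using that R(3) S(3) by auto
  show "x \<in> A \<union> B \<and> y \<in> A \<union> B" if "(x, y) \<in> r \<union> s" for x y using that R(4,5) S(4,5) by auto
  show "x = y" if "(x, y) \<in> r \<union> s" "(y, x) \<in> r \<union> s" for x y
    using that unfolding Un_iff by (elim disjE; metis R(4-6) S(4-6) AB')
  show "(x, z) \<in> r \<union> s" if "(x, y) \<in> r \<union> s" "(y, z) \<in> r \<union> s" for x y z
    using that unfolding Un_iff by (elim disjE; metis R(4,5,7) S(4,5,7) AB')
qed

lemma poset_triangle_iff:
  "r \<in> posets_on A \<Longrightarrow> (x, y) \<in> r \<triangledown> s \<longleftrightarrow> (x, y) \<in> r \<or> (x, y) \<in> s \<or> x \<in> min_elems s \<and> y \<in> A"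
  by (auto simp: poset_triangle_def Field_posets_on)

lemma posets_on_triangle:
  assumes r: "r \<in> posets_on A" and s: "s \<in> posets_on B" and AB: "A \<inter> B = {}"
  shows "r \<triangledown> s \<in> posets_on (A \<union> B)"
proof (rule posets_onI)
  note R = posets_onD[OF r] and S = posets_onD[OF s] and i = poset_triangle_iff[OF r]
  have AB': "x \<notin> B" if "x \<in> A" for x using that AB by blast
  have mB: "x \<in> B" if "x \<in> min_elems s" for x using that min_elems_iff[OF s] by blast
  have mE: "y = x" if "x \<in> min_elems s" "(y, x) \<in> s" for x y using that min_elems_iff[OF s] by blast
  show "finite (A \<union> B)" "A \<union> B \<noteq> {}" using R(1,2) S(1) by auto
  show "(x, x) \<in> r \<triangledown> s" if "x \<in> A \<union> B" for x using that R(3) S(3) by (auto simp: i)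
  show "x \<in> A \<union> B \<and> y \<in> A \<union> B" if "(x, y) \<in> r \<triangledown> s" for x y
    using that R(4,5) S(4,5) mB by (auto simp: i)
  show "x = y" if "(x, y) \<in> r \<triangledown> s" "(y, x) \<in> r \<triangledown> s" for x y
    using that unfolding i by (elim disjE conjE; metis R(4-6) S(4-6) mB AB')
  show "(x, z) \<in> r \<triangledown> s" if "(x, y) \<in> r \<triangledown> s" "(y, z) \<in> r \<triangledown> s" for x y z
    using that unfolding i by (elim disjE conjE; metis R(4,5,7) S(4,5,7) mB mE AB')
qed

text \<open>Every element of \<open>r\<close> has a minimal element of \<open>s\<close> below it,
  and no element of \<open>r\<close> lies below one of \<open>s\<close>. This fact drives both the
  third relation and the recovery of the two parts of a triangle.\<close>

lemma min_elems_triangle: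
  assumes r: "r \<in> posets_on A" and s: "s \<in> posets_on B" and AB: "A \<inter> B = {}"
  shows "min_elems (r \<triangledown> s) = min_elems s"
proof (intro subset_antisym subsetI)
  note i = poset_triangle_iff[OF r] and M = min_elems_iff[OF posets_on_triangle[OF assms]]
  obtain b where b: "b \<in> min_elems s" using posets_onD(2)[OF s] ex_min_elem_below[OF s] by blast
  then have "b \<in> B" by (simp add: min_elems_iff[OF s])
  fix x
  show "x \<in> min_elems s" if "x \<in> min_elems (r \<triangledown> s)"
    using that b \<open>b \<in> B\<close> AB unfolding M i min_elems_iff[OF s] by blast
  show "x \<in> min_elems (r \<triangledown> s)" if "x \<in> min_elems s"
    using that posets_onD(5)[OF r] AB unfolding M i min_elems_iff[OF s] by blast
qed

lemma leaves_nonempty: "leaves t \<noteq> []"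
  by (induction t) auto

lemma eval_tree_closed: "distinct (leaves t) \<Longrightarrow> eval_tree t \<in> posets_on (set (leaves t))"
proof (induction t)
  case (Node g s t)
  then show ?case
    by (cases g) (auto intro!: posets_on_union posets_on_triangle)
qed (simp add: singleton_poset)

lemma eval_tree_trees_on: "t \<in> trees_on A \<Longrightarrow> eval_tree t \<in> posets_on A"
  using eval_tree_closed by (auto simp: trees_on_def)

lemma Field_eval_tree: "distinct (leaves t) \<Longrightarrow> Field (eval_tree t) = set (leaves t)"
  by (rule Field_posets_on[OF eval_tree_closed])

lemma leaves_map_tree [simp]: "leaves (map_tree id \<sigma> t) = map \<sigma> (leaves t)"
  by (induction t) auto

lemma map_prod_image_triangle:
  assumes r: "r \<in> posets_on A" and s: "s \<in> posets_on B" and \<sigma>: "inj_on \<sigma> B"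
  shows "map_prod \<sigma> \<sigma> ` (r \<triangledown> s) = map_prod \<sigma> \<sigma> ` r \<triangledown> map_prod \<sigma> \<sigma> ` s"
proof -
  have "Field (map_prod \<sigma> \<sigma> ` r) = \<sigma> ` Field r"
    by (force simp: Field_def)
  moreover have "min_elems (map_prod \<sigma> \<sigma> ` s) = \<sigma> ` min_elems s"
    using min_elems_relabel[OF s inj_on_imp_bij_betw[OF \<sigma>]] .
  ultimately show ?thesis
    by (auto simp: poset_triangle_def image_Un)
qed

lemma eval_tree_relabel:
  assumes "distinct (leaves t)" "inj_on \<sigma> (set (leaves t))"
  shows "eval_tree (map_tree id \<sigma> t) = map_prod \<sigma> \<sigma> ` eval_tree t"
  using assms
proof (induction t)
  case (Node g s t)
  then have "map_prod \<sigma> \<sigma> ` (eval_tree s \<triangledown> eval_tree t)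
      = map_prod \<sigma> \<sigma> ` eval_tree s \<triangledown> map_prod \<sigma> \<sigma> ` eval_tree t"
    by (intro map_prod_image_triangle[OF eval_tree_closed eval_tree_closed]) (auto simp: inj_on_Un)
  with Node show ?case
    by (cases g) (auto simp: image_Un inj_on_Un)
qed auto

lemma graft_idle [simp]: "a \<notin> set (leaves t) \<Longrightarrow> graft a t u = t"
  by (induction t) auto

lemma set_leaves_graft:
  "a \<in> set (leaves t) \<Longrightarrow> distinct (leaves t) \<Longrightarrow> set (leaves (graft a t u)) = (set (leaves t) - {a}) \<union> set (leaves u)"
proof (induction t)
  case (Node g s t)
  show ?case
  proof (cases "a \<in> set (leaves s)")
    case True
    with Node.prems have "a \<notin> set (leaves t)" by auto
    with True Node show ?thesis by auto
  next
    case False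
    with Node show ?thesis by auto
  qed
qed auto

lemma distinct_leaves_graft:
  "\<lbrakk>distinct (leaves t); distinct (leaves u); set (leaves t) \<inter> set (leaves u) = {}\<rbrakk>
    \<Longrightarrow> distinct (leaves (graft a t u))"
proof (induction t)
  case (Node g s t)
  show ?case
  proof (cases "a \<in> set (leaves s)")
    case True
    with Node.prems have "a \<notin> set (leaves t)" by auto
    with True Node show ?thesis by (auto simp: set_leaves_graft)
  next
    case False
    with Node show ?thesis by (cases "a \<in> set (leaves t)") (auto simp: set_leaves_graft)
  qed
qed auto

lemma graft_trees_on:
  "\<lbrakk>t \<in> trees_on A; u \<in> trees_on B; A \<inter> B = {}; a \<in> A\<rbrakk> \<Longrightarrow> graft a t u \<in> trees_on ((A - {a}) \<union> B)"
  by (auto simp: trees_on_def set_leaves_graft distinct_leaves_graft)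

lemma map_tree_trees_on:
  "\<lbrakk>t \<in> trees_on A; bij_betw \<sigma> A B\<rbrakk> \<Longrightarrow> map_tree id \<sigma> t \<in> trees_on B"
  by (auto simp: trees_on_def bij_betw_def distinct_map)

lemma poset_comp_union:
  assumes r: "r \<in> posets_on A" and r': "r' \<in> posets_on A'" and s: "s \<in> posets_on B"
    and d: "A \<inter> A' = {}" "A' \<inter> B = {}" and a: "a \<in> A"
  shows "poset_comp a (r \<union> r') s = poset_comp a r s \<union> r'"
proof -
  have "a \<notin> A'" using a d by blast
  then have "(x, a) \<notin> r'" "(a, x) \<notin> r'" for x using posets_onD(4,5)[OF r'] by blast+
  then show ?thesis
    unfolding set_eq_iff split_paired_All Un_iff poset_comp_iff[OF s] by metis
qed

text \<open>The minimal elements of \<open>r'\<close> lie below \<open>a\<close>, so the third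
  clause of \<open>poset_comp\<close> puts them below all of \<open>s\<close>, as the triangle with
  the enlarged upper part demands.\<close>

lemma poset_comp_triangle_left:
  assumes r: "r \<in> posets_on A" and r': "r' \<in> posets_on A'" and s: "s \<in> posets_on B"
    and d: "A \<inter> A' = {}" "A \<inter> B = {}" "A' \<inter> B = {}" and a: "a \<in> A"
  shows "poset_comp a (r \<triangledown> r') s = poset_comp a r s \<triangledown> r'"
proof -
  have "a \<notin> A'" using a d by blast
  then have "(x, a) \<notin> r'" "(a, x) \<notin> r'" "a \<notin> min_elems r'" for x
    using posets_onD(4,5)[OF r'] min_elems_iff[OF r'] by blast+
  then show ?thesis
    unfolding set_eq_iff split_paired_All poset_comp_iff[OF s] poset_triangle_iff[OF r]
      poset_triangle_iff[OF poset_comp_closed[OF r s d(2) a]]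
    using a by auto
qed

text \<open>Insertion may change the minimal elements of the lower part. If \<open>a\<close> is
  minimal in \<open>r'\<close>, it lies below all of \<open>r\<close>, and the fourth clause of
  \<open>poset_comp\<close> hands this on to the minimal elements of \<open>s\<close>, which are the
  ones that replace \<open>a\<close>.\<close>

lemma poset_comp_triangle_right:
  assumes r: "r \<in> posets_on A" and r': "r' \<in> posets_on A'" and s: "s \<in> posets_on B"
    and d: "A \<inter> A' = {}" "A \<inter> B = {}" "A' \<inter> B = {}" and a: "a \<in> A'"
  shows "poset_comp a (r \<triangledown> r') s = r \<triangledown> poset_comp a r' s"
proof -
  have "a \<notin> A" using a d by blast
  then have "(x, a) \<notin> r" "(a, x) \<notin> r" for x
    using posets_onD(4,5)[OF r] by blast+
  then show ?thesis
    unfolding set_eq_iff split_paired_All poset_comp_iff[OF s] poset_triangle_iff[OF r]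
      min_elems_poset_comp[OF r' s d(3) a]
    using \<open>a \<notin> A\<close> by auto
qed

text \<open>Leaves are distinct, so exactly one subtree contains \<open>a\<close>, and
  \<open>graft\<close> leaves the other alone.\<close>

lemma eval_tree_graft:
  assumes "distinct (leaves t)" "distinct (leaves u)" "set (leaves t) \<inter> set (leaves u) = {}"
    "a \<in> set (leaves t)"
  shows "eval_tree (graft a t u) = poset_comp a (eval_tree t) (eval_tree u)"
  using assms
proof (induction t)
  case (Leaf b)
  then show ?case by (auto simp: poset_comp_def)
next
  case (Node g s t)
  have e: "eval_tree s \<in> posets_on (set (leaves s))" "eval_tree t \<in> posets_on (set (leaves t))"
    "eval_tree u \<in> posets_on (set (leaves u))"
    using Node.prems by (auto intro: eval_tree_closed)
  have d: "set (leaves s) \<inter> set (leaves t) = {}" "set (leaves s) \<inter> set (leaves u) = {}"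
    "set (leaves t) \<inter> set (leaves u) = {}"
    using Node.prems by auto
  show ?case
  proof (cases "a \<in> set (leaves s)")
    case True
    with d have "a \<notin> set (leaves t)" by auto
    with True Node d show ?thesis
      by (cases g) (simp_all add: poset_comp_union[OF e d(1,3)] poset_comp_triangle_left[OF e d])
  next
    case False
    \<comment> \<open>\<open>poset_comp_union\<close> inserts into the first summand, so the union
      is read in the opposite order here.\<close>
    have d': "set (leaves t) \<inter> set (leaves s) = {}" using d by auto
    show ?thesis
      using False Node d poset_comp_union[OF e(2,1,3) d' d(2)] poset_comp_triangle_right[OF e d]
      by (cases g) (simp_all add: Un_commute)
  qed
qed

section \<open>Compatible posets are those built from trees\<close>

lemma hasse_subset: "hasse r \<subseteq> r"
  by (auto simp: hasse_def)

text \<open>Induction on the size of an interval: an intermediate element splits it into two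
  strictly smaller ones, each omitting an endpoint.\<close>

lemma posets_on_subset_rtrancl_hasse:
  assumes r: "r \<in> posets_on A"
  shows "r \<subseteq> (hasse r)\<^sup>*"
proof -
  note R = posets_onD[OF r]
  have "(x, y) \<in> (hasse r)\<^sup>*" if "(x, y) \<in> r" for x y
    using that
  proof (induction "card {z. (x, z) \<in> r \<and> (z, y) \<in> r}" arbitrary: x y rule: less_induct)
    case less
    have fin: "finite {z. (x, z) \<in> r \<and> (z, y) \<in> r}"
      by (rule finite_subset[OF _ R(1)]) (use R(4) in auto)
    show ?case
    proof (cases "x = y \<or> (x, y) \<in> hasse r")
      case False
      then obtain z where z: "(x, z) \<in> r" "(z, y) \<in> r" "z \<noteq> x" "z \<noteq> y"
        using less.prems by (auto simp: hasse_def)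
      have "{w. (x, w) \<in> r \<and> (w, z) \<in> r} \<subset> {w. (x, w) \<in> r \<and> (w, y) \<in> r}"
        "{w. (z, w) \<in> r \<and> (w, y) \<in> r} \<subset> {w. (x, w) \<in> r \<and> (w, y) \<in> r}"
        using z less.prems R(3)[of x] R(3)[of y] R(4)[OF less.prems] R(5)[OF less.prems]
        by (auto intro: R(7) dest: R(6))
      then have "(x, z) \<in> (hasse r)\<^sup>*" "(z, y) \<in> (hasse r)\<^sup>*"
        using less.hyps z fin by (simp_all add: psubset_card_mono)
      then show ?thesis by (rule rtrancl_trans)
    qed auto
  qed
  then show ?thesis by auto
qed

text \<open>Chains of covers refine comparabilities, so covers can be replaced by the order itself
  in every later argument about connectedness.\<close>

lemma hasse_path_eq:
  assumes r: "r \<in> posets_on A"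
  shows "hasse_path r = (r \<union> r\<inverse>)\<^sup>* \<inter> A \<times> A"
proof -
  have "r \<subseteq> (hasse r \<union> (hasse r)\<inverse>)\<^sup>*"
    using posets_on_subset_rtrancl_hasse[OF r] rtrancl_mono[of "hasse r" "hasse r \<union> (hasse r)\<inverse>"]
    by blast
  moreover have "r\<inverse> \<subseteq> ((hasse r)\<inverse>)\<^sup>*"
    using posets_on_subset_rtrancl_hasse[OF r] by (auto simp: rtrancl_converse)
  then have "r\<inverse> \<subseteq> (hasse r \<union> (hasse r)\<inverse>)\<^sup>*"
    using rtrancl_mono[of "(hasse r)\<inverse>" "hasse r \<union> (hasse r)\<inverse>"] by blast
  ultimately have "(r \<union> r\<inverse>)\<^sup>* \<subseteq> (hasse r \<union> (hasse r)\<inverse>)\<^sup>*"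
    by (intro rtrancl_subset_rtrancl) simp
  moreover have "(hasse r \<union> (hasse r)\<inverse>)\<^sup>* \<subseteq> (r \<union> r\<inverse>)\<^sup>*"
    using hasse_subset[of r] by (intro rtrancl_mono) auto
  ultimately show ?thesis
    by (auto simp: hasse_path_def Field_posets_on[OF r])
qed

lemma equiv_hasse_path:
  assumes r: "r \<in> posets_on A"
  shows "equiv A (hasse_path r)"
  unfolding hasse_path_eq[OF r]
proof (rule equivI)
  have "sym ((r \<union> r\<inverse>)\<^sup>*)" by (intro sym_rtrancl sym_Un_converse)
  then show "sym ((r \<union> r\<inverse>)\<^sup>* \<inter> A \<times> A)" by (auto simp: sym_def)
  show "trans ((r \<union> r\<inverse>)\<^sup>* \<inter> A \<times> A)" by (auto simp: trans_def intro: rtrancl_trans)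
qed (auto simp: refl_on_def)

lemma subset_hasse_path: "r \<in> posets_on A \<Longrightarrow> r \<subseteq> hasse_path r"
  using posets_on_subset[of r A] by (auto simp: hasse_path_eq)

text \<open>Bounds the path relation of a disjoint union from above: the union of the two path
  relations is already an equivalence.\<close>

lemma hasse_path_least:
  assumes r: "r \<in> posets_on A" and E: "equiv A E" "r \<subseteq> E"
  shows "hasse_path r \<subseteq> E"
proof -
  have "(x, y) \<in> E" if "(x, y) \<in> (r \<union> r\<inverse>)\<^sup>*" "x \<in> A" for x y
    using that
  proof (induction rule: rtrancl_induct)
    case base
    then show ?case using E(1) by (auto simp: equiv_def refl_on_def)
  next
    case (step y z)
    then show ?case using E by (auto simp: equiv_def dest: symD transD)
  qed
  then show ?thesis by (auto simp: hasse_path_eq[OF r])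
qed

lemma equiv_disjoint_union:
  assumes "equiv A E" "equiv B F" "A \<inter> B = {}"
  shows "equiv (A \<union> B) (E \<union> F)"
proof (rule equivI)
  have sub: "E \<subseteq> A \<times> A" "F \<subseteq> B \<times> B" using assms equiv_type by blast+
  then show "E \<union> F \<subseteq> (A \<union> B) \<times> (A \<union> B)" by blast
  show "refl_on (A \<union> B) (E \<union> F)" using assms by (auto simp: equiv_def refl_on_def)
  show "sym (E \<union> F)" using assms by (auto simp: equiv_def intro: sym_Un)
  have "trans E" "trans F" using assms by (auto simp: equiv_def)
  then show "trans (E \<union> F)" using assms(3) sub unfolding trans_def by blast
qed

lemma hasse_path_union:
  assumes r: "r \<in> posets_on A" and s: "s \<in> posets_on B" and AB: "A \<inter> B = {}"
  shows "hasse_path (r \<union> s) = hasse_path r \<union> hasse_path s"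
proof
  show "hasse_path (r \<union> s) \<subseteq> hasse_path r \<union> hasse_path s"
    using Un_mono[OF subset_hasse_path[OF r] subset_hasse_path[OF s]]
    by (rule hasse_path_least[OF posets_on_union[OF assms]
          equiv_disjoint_union[OF equiv_hasse_path[OF r] equiv_hasse_path[OF s] AB]])
  have "(r \<union> r\<inverse>)\<^sup>* \<subseteq> (r \<union> s \<union> (r \<union> s)\<inverse>)\<^sup>*" "(s \<union> s\<inverse>)\<^sup>* \<subseteq> (r \<union> s \<union> (r \<union> s)\<inverse>)\<^sup>*"
    by (intro rtrancl_mono; blast)+
  then show "hasse_path r \<union> hasse_path s \<subseteq> hasse_path (r \<union> s)"
    by (auto simp: hasse_path_eq[OF r] hasse_path_eq[OF s] hasse_path_eq[OF posets_on_union[OF assms]])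
qed

lemma not_connected_union:
  assumes r: "r \<in> posets_on A" and s: "s \<in> posets_on B" and AB: "A \<inter> B = {}"
  shows "\<not> connected_poset (r \<union> s)"
proof -
  obtain a b where "a \<in> A" "b \<in> B" using posets_onD(2)[OF r] posets_onD(2)[OF s] by blast
  moreover have "hasse_path r \<subseteq> A \<times> A" "hasse_path s \<subseteq> B \<times> B"
    using equiv_hasse_path[OF r] equiv_hasse_path[OF s] equiv_type by blast+
  ultimately have "(a, b) \<notin> hasse_path (r \<union> s)"
    using AB by (auto simp: hasse_path_union[OF assms])
  with \<open>a \<in> A\<close> \<open>b \<in> B\<close> show ?thesis
    unfolding connected_poset_def Field_posets_on[OF posets_on_union[OF assms]] by blast
qed

lemma poset_components_union:
  assumes r: "r \<in> posets_on A" and s: "s \<in> posets_on B" and AB: "A \<inter> B = {}"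
  shows "poset_components (r \<union> s) = poset_components r \<union> poset_components s"
proof -
  have sub: "hasse_path r \<subseteq> A \<times> A" "hasse_path s \<subseteq> B \<times> B"
    using equiv_hasse_path[OF r] equiv_hasse_path[OF s] equiv_type by blast+
  have A: "(r \<union> s) \<inter> C \<times> C = r \<inter> C \<times> C" if "C \<subseteq> A" for C
    using that posets_on_subset[OF s] AB by blast
  have B: "(r \<union> s) \<inter> C \<times> C = s \<inter> C \<times> C" if "C \<subseteq> B" for C
    using that posets_on_subset[OF r] AB by blast
  have "(hasse_path r \<union> hasse_path s) `` {x} = hasse_path r `` {x}" if "x \<in> A" for x
    using that AB sub by blast
  moreover have "(hasse_path r \<union> hasse_path s) `` {x} = hasse_path s `` {x}" if "x \<in> B" for x
    using that AB sub by blast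
  ultimately have "(A \<union> B) // (hasse_path r \<union> hasse_path s) = A // hasse_path r \<union> B // hasse_path s"
    by (simp add: quotient_def)
  moreover have "C \<subseteq> A" if "C \<in> A // hasse_path r" for C
    using that sub by (auto simp: quotient_def)
  moreover have "C \<subseteq> B" if "C \<in> B // hasse_path s" for C
    using that sub by (auto simp: quotient_def)
  ultimately show ?thesis
    by (simp add: poset_components_def hasse_path_union[OF assms] Field_posets_on[OF r]
        Field_posets_on[OF s] Field_posets_on[OF posets_on_union[OF assms]] image_Un A B)
qed

lemma poset_components_connected:
  assumes r: "r \<in> posets_on A" and c: "connected_poset r"
  shows "poset_components r = {r}"
proof -
  have "A // (A \<times> A) = {A}" using posets_onD(2)[OF r] by (auto simp: quotient_def)
  then show ?thesis
    using c posets_on_subset[OF r]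
    by (auto simp: poset_components_def connected_poset_def Field_posets_on[OF r])
qed

lemma connected_posetI:
  assumes r: "r \<in> posets_on A" and "c \<in> A" "\<And>x. x \<in> A \<Longrightarrow> (x, c) \<in> hasse_path r"
  shows "connected_poset r"
  unfolding connected_poset_def Field_posets_on[OF r]
  using assms equiv_hasse_path[OF r] by (auto simp: equiv_def) (meson symD transD)

lemma connected_singleton: "connected_poset {(a, a)}"
  using equiv_hasse_path[OF singleton_poset[of a]]
  by (auto simp: equiv_def refl_on_def intro: connected_posetI[OF singleton_poset])

section \<open>Connectedness of triangles and recovery of their parts\<close>

text \<open>Elements are joined by zigzags: from an element of \<open>s\<close> down to a minimal
  one, then up to an element of \<open>r\<close>, which lies above all minimal elements of
  \<open>s\<close>.\<close>

lemma connected_triangle: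
  assumes r: "r \<in> posets_on A" and s: "s \<in> posets_on B" and AB: "A \<inter> B = {}"
  shows "connected_poset (r \<triangledown> s)"
proof -
  note T = posets_on_triangle[OF assms] and i = poset_triangle_iff[OF r]
  let ?E = "hasse_path (r \<triangledown> s)"
  have E: "sym ?E" "trans ?E" "r \<triangledown> s \<subseteq> ?E"
    using equiv_hasse_path[OF T] subset_hasse_path[OF T] by (auto simp: equiv_def)
  obtain b where b: "b \<in> min_elems s"
    using posets_onD(2)[OF s] ex_min_elem_below[OF s] by blast
  then have "b \<in> B" by (simp add: min_elems_iff[OF s])
  obtain a where a: "a \<in> A" using posets_onD(2)[OF r] by blast
  have A: "(b, x) \<in> ?E" if "x \<in> A" for x using b that E(3) i by blast
  have B: "(b, x) \<in> ?E" if "x \<in> B" for x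
  proof -
    obtain m where m: "m \<in> min_elems s" "(m, x) \<in> s" using ex_min_elem_below[OF s \<open>x \<in> B\<close>] by blast
    then have "(m, x) \<in> ?E" "(m, a) \<in> ?E" using E(3) a i by blast+
    then show ?thesis using A[OF a] E(1,2) by (meson symD transD)
  qed
  show ?thesis
    using A B E(1) \<open>b \<in> B\<close> by (intro connected_posetI[OF T, of b]) (auto dest: symD)
qed

text \<open>An element above all minimal elements would be joined to each \<open>x\<close> through a
  minimal element below \<open>x\<close>, making the poset connected.\<close>

lemma AboveS_min_elems_disconnected:
  assumes s: "s \<in> posets_on B" and "\<not> connected_poset s"
  shows "AboveS s (min_elems s) = {}"
proof (rule ccontr)
  assume "AboveS s (min_elems s) \<noteq> {}"
  then obtain y where y: "y \<in> B" "\<And>m. m \<in> min_elems s \<Longrightarrow> (m, y) \<in> s"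
    by (auto simp: AboveS_def Field_posets_on[OF s])
  let ?E = "hasse_path s"
  have E: "sym ?E" "trans ?E" "s \<subseteq> ?E"
    using equiv_hasse_path[OF s] subset_hasse_path[OF s] by (auto simp: equiv_def)
  have "(x, y) \<in> ?E" if x: "x \<in> B" for x
  proof -
    obtain m where m: "m \<in> min_elems s" "(m, x) \<in> s" using ex_min_elem_below[OF s x] by blast
    then have "(m, x) \<in> ?E" "(m, y) \<in> ?E" using E(3) y(2) by blast+
    then show ?thesis using E(1,2) by (meson symD transD)
  qed
  then show False using connected_posetI[OF s y(1)] assms(2) by blast
qed

lemma AboveS_min_elems_singleton: "AboveS {(a, a)} (min_elems {(a, a)}) = {}"
  by (auto simp: AboveS_def min_elems_singleton)

text \<open>The elements strictly above all minimal ones are those of \<open>r\<close> together with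
  those that have this property already inside \<open>s\<close>; the last hypothesis excludes the
  latter. Under it, a triangle remembers both arguments.\<close>

lemma parts_triangle:
  assumes r: "r \<in> posets_on A" and s: "s \<in> posets_on B" and AB: "A \<inter> B = {}"
    and above: "AboveS s (min_elems s) = {}"
  shows "b_part (r \<triangledown> s) = r" "r_part (r \<triangledown> s) = s"
proof -
  have m: "min_elems s \<subseteq> B" "min_elems s \<noteq> {}"
    using posets_onD(2)[OF s] ex_min_elem_below[OF s] min_elems_iff[OF s] by blast+
  have "AboveS (r \<triangledown> s) (min_elems s) = A"
  proof
    show "A \<subseteq> AboveS (r \<triangledown> s) (min_elems s)"
      using m AB by (auto simp: AboveS_def poset_triangle_iff[OF r]
          Field_posets_on[OF posets_on_triangle[OF r s AB]])
    show "AboveS (r \<triangledown> s) (min_elems s) \<subseteq> A"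
    proof
      fix y
      assume y: "y \<in> AboveS (r \<triangledown> s) (min_elems s)"
      then have "y \<in> A \<union> B"
        by (simp add: AboveS_def Field_posets_on[OF posets_on_triangle[OF r s AB]])
      moreover have "y \<notin> B"
      proof
        assume "y \<in> B"
        then have "y \<notin> A" using AB by blast
        then have "y \<noteq> m \<and> (m, y) \<in> s" if "m \<in> min_elems s" for m
          using y that posets_onD(5)[OF r] by (auto simp: AboveS_def poset_triangle_iff[OF r])
        then have "y \<in> AboveS s (min_elems s)"
          using \<open>y \<in> B\<close> by (auto simp: AboveS_def Field_posets_on[OF s])
        then show False using above by blast
      qed
      ultimately show "y \<in> A" by blast
    qed
  qed
  moreover have "A \<union> B - A = B" using AB by blast
  ultimately have "b_part (r \<triangledown> s) = (r \<triangledown> s) \<inter> A \<times> A" "r_part (r \<triangledown> s) = (r \<triangledown> s) \<inter> B \<times> B"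
    by (simp_all add: b_part_def r_part_def min_elems_triangle[OF r s AB]
        Field_posets_on[OF posets_on_triangle[OF r s AB]])
  moreover have "(r \<triangledown> s) \<inter> A \<times> A = r" "(r \<triangledown> s) \<inter> B \<times> B = s"
    using AB posets_on_subset[OF r] posets_on_subset[OF s] m(1)
    unfolding set_eq_iff split_paired_All Int_iff poset_triangle_iff[OF r] by blast+
  ultimately show "b_part (r \<triangledown> s) = r" "r_part (r \<triangledown> s) = s" by simp_all
qed

section \<open>Closure of compatible posets under the two operations\<close>

lemma posets_on_restrict:
  assumes r: "r \<in> posets_on A" and "C \<subseteq> A" "C \<noteq> {}"
  shows "r \<inter> C \<times> C \<in> posets_on C"
proof (rule posets_onI)
  note R = posets_onD[OF r]
  show "finite C" using R(1) assms(2) finite_subset by blast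
  show "(x, x) \<in> r \<inter> C \<times> C" if "x \<in> C" for x using that R(3) assms(2) by blast
  show "x = y" if "(x, y) \<in> r \<inter> C \<times> C" "(y, x) \<in> r \<inter> C \<times> C" for x y using that R(6) by blast
  show "(x, z) \<in> r \<inter> C \<times> C" if "(x, y) \<in> r \<inter> C \<times> C" "(y, z) \<in> r \<inter> C \<times> C" for x y z
    using that R(7)[of x y z] by blast
qed (use assms in auto)

text \<open>A connected poset is its own only component, so the statement covers both kinds of
  compatible poset.\<close>

lemma compatible_components:
  assumes "compatible r" "s \<in> poset_components r"
  shows "compatible s"
  using assms(1)
proof cases
  case (singleton a)
  then show ?thesis
    using assms poset_components_connected[OF singleton_poset[of a] connected_singleton] by simp
next
  case (connected A)
  then show ?thesis using assms poset_components_connected[of r A] by simp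
qed (use assms in auto)

text \<open>The summands may be disconnected, so the components to be checked are those of
  \<open>r\<close> and of \<open>s\<close>, not \<open>r\<close> and \<open>s\<close>
  themselves.\<close>

lemma compatible_union:
  assumes r: "r \<in> posets_on A" "compatible r" and s: "s \<in> posets_on B" "compatible s"
    and AB: "A \<inter> B = {}"
  shows "compatible (r \<union> s)"
proof (rule compatible.disconnected)
  show "r \<union> s \<in> posets_on (A \<union> B)" using r s AB by (simp add: posets_on_union)
  have "card A \<ge> 1" "card B \<ge> 1"
    using posets_onD(1,2)[OF r(1)] posets_onD(1,2)[OF s(1)] by (simp_all add: Suc_leI card_gt_0_iff)
  then show "2 \<le> card (A \<union> B)"
    using AB posets_onD(1)[OF r(1)] posets_onD(1)[OF s(1)] by (simp add: card_Un_disjoint)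
  show "\<not> connected_poset (r \<union> s)" using r s AB by (simp add: not_connected_union)
  show "\<forall>t\<in>poset_components (r \<union> s). compatible t"
    using r s AB compatible_components by (auto simp: poset_components_union)
qed

text \<open>The rule \<open>connected\<close> asks about the b-part and r-part of
  \<open>r \<triangledown> s\<close>, and these are \<open>r\<close> and \<open>s\<close> only if
  nothing in \<open>s\<close> lies above all its minimal elements. Otherwise
  \<open>s = b \<triangledown> q\<close>, and \<open>r \<triangledown> (b \<triangledown> q) = (r
  \<union> b) \<triangledown> q\<close> shifts \<open>b\<close> to the left, so that the induction
  hypothesis for \<open>q\<close> applies.\<close>

lemma compatible_triangle:
  assumes "compatible s" "s \<in> posets_on B" "compatible r" "r \<in> posets_on A" "A \<inter> B = {}"
  shows "compatible (r \<triangledown> s)"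
  using assms
proof (induction arbitrary: r A B rule: compatible.induct)
  \<comment> \<open>The case in which \<open>r\<close> and \<open>s\<close> are the parts of their
    triangle; it serves singletons and disconnected \<open>s\<close>.\<close>
  have base: "compatible (r \<triangledown> s)"
    if "compatible s" "s \<in> posets_on B" "compatible r" "r \<in> posets_on A" "A \<inter> B = {}"
      "AboveS s (min_elems s) = {}" for r s :: "'a rel" and A B
  proof (rule compatible.connected)
    show "r \<triangledown> s \<in> posets_on (A \<union> B)" using that by (simp add: posets_on_triangle)
    have "card A \<ge> 1" "card B \<ge> 1"
      using posets_onD(1,2)[OF that(2)] posets_onD(1,2)[OF that(4)] by (simp_all add: Suc_leI card_gt_0_iff)
    then show "2 \<le> card (A \<union> B)"
      using that posets_onD(1)[OF that(2)] posets_onD(1)[OF that(4)] by (simp add: card_Un_disjoint)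
    show "connected_poset (r \<triangledown> s)" using that connected_triangle by blast
    note parts = parts_triangle[OF that(4,2,5,6)]
    show "b_part (r \<triangledown> s) \<noteq> {}"
      using parts posets_onD(2,3)[OF that(4)] by auto
    show "compatible (b_part (r \<triangledown> s))" "compatible (r_part (r \<triangledown> s))"
      "r \<triangledown> s = b_part (r \<triangledown> s) \<triangledown> r_part (r \<triangledown> s)"
      using that by (simp_all add: parts)
  qed
  {
    case (singleton a)
    then show ?case
      using AboveS_min_elems_singleton[of a] by (intro base[of _ B _ A] compatible.singleton)
  next
    case (disconnected s A')
    have "compatible s"
      by (rule compatible.disconnected) (use disconnected in auto)
    then show ?case
      using AboveS_min_elems_disconnected[OF disconnected.hyps(1,3)] disconnected.prems
      by (intro base[of _ B _ A])
  next
    case (connected s A')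
    define C where "C = AboveS s (min_elems s)"
    have B: "A' = B" using connected.hyps(1) connected.prems(1) Field_posets_on by blast
    obtain b where "b \<in> min_elems s"
      using posets_onD(2)[OF connected.hyps(1)] ex_min_elem_below[OF connected.hyps(1)] by blast
    then have "b \<in> B" "b \<notin> C"
      by (auto simp: C_def AboveS_def min_elems_iff[OF connected.prems(1)])
    then have "B - C \<noteq> {}" by blast
    have CB: "C \<subseteq> B" by (auto simp: C_def AboveS_def Field_posets_on[OF connected.prems(1)])
    have "C \<noteq> {}" using connected.hyps(4) by (auto simp: C_def b_part_def)
    have b: "b_part s \<in> posets_on C"
      using posets_on_restrict[OF connected.prems(1) CB \<open>C \<noteq> {}\<close>] by (simp add: b_part_def C_def)
    have r_part: "r_part s \<in> posets_on (B - C)"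
      using posets_on_restrict[OF connected.prems(1) _ \<open>B - C \<noteq> {}\<close>]
      by (simp add: r_part_def C_def Field_posets_on[OF connected.prems(1)])
    have AC: "A \<inter> C = {}" using connected.prems CB by blast
    have "(A \<union> C) \<inter> (B - C) = {}" using connected.prems(4) by blast
    then have "compatible ((r \<union> b_part s) \<triangledown> r_part s)"
      by (rule connected.IH(2)[OF r_part compatible_union[OF connected.prems(3,2) b connected.hyps(5) AC]
            posets_on_union[OF connected.prems(3) b AC]])
    \<comment> \<open>\<open>s\<close> and its r-part have the same minimal elements, so both sides
      put the same elements below \<open>r\<close>.\<close>
    moreover have "(r \<union> b_part s) \<triangledown> r_part s = r \<triangledown> s"
    proof -
      have "min_elems s = min_elems (r_part s)"
        by (subst connected.hyps(7), rule min_elems_triangle[OF b r_part]) auto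
      then have "r \<triangledown> s = r \<union> (b_part s \<triangledown> r_part s) \<union> min_elems (r_part s) \<times> Field r"
        using connected.hyps(7) by (simp add: poset_triangle_def[of r])
      then show ?thesis
        by (auto simp: poset_triangle_def)
    qed
    ultimately show ?case by simp
  }
qed

lemma compatible_eval_tree: "distinct (leaves t) \<Longrightarrow> compatible (eval_tree t)"
proof (induction t)
  case (Node g s t)
  then have "compatible (eval_tree s)" "compatible (eval_tree t)" "set (leaves s) \<inter> set (leaves t) = {}"
    "eval_tree s \<in> posets_on (set (leaves s))" "eval_tree t \<in> posets_on (set (leaves t))"
    by (auto intro: eval_tree_closed)
  then show ?case
    by (cases g) (auto intro: compatible_union compatible_triangle)
qed (simp add: compatible.singleton)

lemma ex_tree_compatible:
  "compatible r \<Longrightarrow> \<exists>t. distinct (leaves t) \<and> eval_tree t = r"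
proof (induction rule: compatible.induct)
  case (singleton a)
  then show ?case by (intro exI[of _ "Leaf a"]) simp
next
  case (disconnected r A)
  note r = disconnected.hyps(1)
  let ?E = "hasse_path r"
  note E = equiv_hasse_path[OF r]
  \<comment> \<open>\<open>m\<close> is binary but a poset may have many components, so they are
    joined one at a time. The induction runs over sets of classes, since the induction hypothesis on
    posets supplies trees for single components only.\<close>
  have glue: "\<exists>t. distinct (leaves t) \<and> eval_tree t = r \<inter> (\<Union>C\<in>\<D>. C \<times> C)"
    if "finite \<D>" "\<D> \<noteq> {}" "\<D> \<subseteq> A // ?E" for \<D>
    using that
  proof (induction rule: finite_ne_induct)
    case (singleton C)
    then show ?case
      using disconnected.IH by (auto simp: poset_components_def Field_posets_on[OF r])
  next
    case (insert C \<D>)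
    have tree: "r \<inter> (\<Union>C\<in>\<D>. C \<times> C) = r \<inter> \<Union>\<D> \<times> \<Union>\<D>"
    proof -
      have "D = D'" if "(x, y) \<in> r" "x \<in> D" "y \<in> D'" "D \<in> \<D>" "D' \<in> \<D>" for x y D D'
        using that insert.prems subset_hasse_path[OF r] quotient_eq_iff[OF E, of D D' x y] by blast
      then show ?thesis by blast
    qed
    obtain t where t: "distinct (leaves t)" "eval_tree t = r \<inter> C \<times> C"
      using disconnected.IH insert.prems by (auto simp: poset_components_def Field_posets_on[OF r])
    obtain u where u: "distinct (leaves u)" "eval_tree u = r \<inter> (\<Union>C\<in>\<D>. C \<times> C)"
      using insert by auto
    have "Field (r \<inter> C \<times> C) \<subseteq> C" "Field (r \<inter> (\<Union>C\<in>\<D>. C \<times> C)) \<subseteq> \<Union>\<D>"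
      by (auto simp: Field_def)
    then have "set (leaves t) \<subseteq> C" "set (leaves u) \<subseteq> \<Union>\<D>"
      using Field_eval_tree[OF t(1)] Field_eval_tree[OF u(1)] t(2) u(2) by auto
    moreover have "C \<inter> D = {}" if "D \<in> \<D>" for D
      using quotient_disj[OF E, of C D] that insert by blast
    ultimately have "set (leaves t) \<inter> set (leaves u) = {}" by blast
    then show ?case
      using t u by (intro exI[of _ "Node Gen_m t u"]) auto
  qed
  have "finite (A // ?E)" using posets_onD(1)[OF r] E by (simp add: equiv_type finite_quotient)
  moreover have "A // ?E \<noteq> {}" using posets_onD(2)[OF r] by (auto simp: quotient_def)
  ultimately obtain t where "distinct (leaves t)" "eval_tree t = r \<inter> (\<Union>C\<in>A // ?E. C \<times> C)"
    using glue by blast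
  \<comment> \<open>Comparable elements lie in one class, so restricting \<open>r\<close> to the
    classes loses nothing.\<close>
  moreover have "r \<subseteq> (\<Union>C\<in>A // ?E. C \<times> C)"
  proof (rule subrelI)
    fix x y assume xy: "(x, y) \<in> r"
    then have "?E `` {x} \<in> A // ?E" "x \<in> ?E `` {x}" "y \<in> ?E `` {x}"
      using posets_onD(4)[OF r xy] subset_hasse_path[OF r] xy equiv_class_self[OF E, of x]
      by (auto simp: quotientI)
    then show "(x, y) \<in> (\<Union>C\<in>A // ?E. C \<times> C)" by blast
  qed
  ultimately show ?case by (auto simp: Int_absorb2)
next
  case (connected r A)
  note r = connected.hyps(1)
  obtain t u where tu: "distinct (leaves t)" "eval_tree t = b_part r" "distinct (leaves u)"
    "eval_tree u = r_part r"
    using connected.IH by blast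
  have "Field (b_part r) \<inter> Field (r_part r) = {}"
    by (auto simp: b_part_def r_part_def Field_def)
  then have "set (leaves t) \<inter> set (leaves u) = {}"
    using Field_eval_tree[OF tu(1)] Field_eval_tree[OF tu(3)] tu(2,4) by simp
  then show ?case
    using tu connected.hyps(7) by (intro exI[of _ "Node Gen_triangle t u"]) auto
qed

lemma compatible_posets_eq: "{r \<in> posets_on A. compatible r} = eval_tree ` trees_on A"
proof
  show "eval_tree ` trees_on A \<subseteq> {r \<in> posets_on A. compatible r}"
    using eval_tree_trees_on compatible_eval_tree by (auto simp: trees_on_def)
  show "{r \<in> posets_on A. compatible r} \<subseteq> eval_tree ` trees_on A"
  proof clarify
    fix r assume r: "r \<in> posets_on A" "compatible r"
    then obtain t where "distinct (leaves t)" "eval_tree t = r" using ex_tree_compatible by blast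
    then show "r \<in> eval_tree ` trees_on A"
      using Field_eval_tree[of t] Field_posets_on[OF r(1)] by (auto simp: trees_on_def)
  qed
qed

section \<open>The word problem\<close>

text \<open>The three relations with arbitrary subtrees in place of labels, closed under contexts.
  No condition on leaves is imposed: their multiset is invariant, so a class that meets
  \<open>trees_on A\<close> stays inside it.\<close>

inductive tree_equiv :: "(generator, 'a) tree \<Rightarrow> (generator, 'a) tree \<Rightarrow> bool"  (infix \<open>\<approx>\<close> 50) where
  refl: "t \<approx> t"
| sym: "s \<approx> t \<Longrightarrow> t \<approx> s"
| trans: "\<lbrakk>s \<approx> t; t \<approx> u\<rbrakk> \<Longrightarrow> s \<approx> u"
| node: "\<lbrakk>s \<approx> s'; t \<approx> t'\<rbrakk> \<Longrightarrow> Node g s t \<approx> Node g s' t'"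
| comm: "Node Gen_m s t \<approx> Node Gen_m t s"
| assoc: "Node Gen_m (Node Gen_m s t) u \<approx> Node Gen_m s (Node Gen_m t u)"
| action: "Node Gen_triangle (Node Gen_m s t) u \<approx> Node Gen_triangle s (Node Gen_triangle t u)"

lemma tree_equiv_leaves: "s \<approx> t \<Longrightarrow> mset (leaves s) = mset (leaves t)"
  by (induction rule: tree_equiv.induct) (auto simp: ac_simps)

lemma tree_equiv_trees_on: "s \<approx> t \<Longrightarrow> s \<in> trees_on A \<longleftrightarrow> t \<in> trees_on A"
  using mset_eq_setD[OF tree_equiv_leaves[of s t]] mset_eq_imp_distinct_iff[OF tree_equiv_leaves[of s t]]
  by (simp add: trees_on_def)

lemma trees_on_Node:
  assumes "Node g s t \<in> trees_on A"
  obtains B C where "s \<in> trees_on B" "t \<in> trees_on C" "B \<inter> C = {}" "A = B \<union> C"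
  using assms that[of "set (leaves s)" "set (leaves t)"] by (auto simp: trees_on_def)

text \<open>\<open>s \<triangledown> t\<close> has the same minimal elements as \<open>t\<close>, so
  on both sides these are what is put below \<open>r\<close> and \<open>s\<close>.\<close>

lemma triangle_action:
  assumes "s \<in> posets_on B" "t \<in> posets_on C" "B \<inter> C = {}"
  shows "(r \<union> s) \<triangledown> t = r \<triangledown> (s \<triangledown> t)"
proof -
  have "r \<triangledown> (s \<triangledown> t) = r \<union> (s \<triangledown> t) \<union> min_elems t \<times> Field r"
    by (simp add: poset_triangle_def[of r] min_elems_triangle[OF assms])
  then show ?thesis by (auto simp: poset_triangle_def)
qed

text \<open>\<open>A\<close> varies because subtrees carry smaller label sets; disjoint labels make
  \<open>triangle_action\<close> available in the case \<open>action\<close>.\<close>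

lemma eval_tree_equiv: "\<lbrakk>s \<approx> t; s \<in> trees_on A\<rbrakk> \<Longrightarrow> eval_tree s = eval_tree t"
proof (induction arbitrary: A rule: tree_equiv.induct)
  case (sym s t)
  then show ?case using tree_equiv_trees_on by metis
next
  case (trans s t u)
  then show ?case using tree_equiv_trees_on by metis
next
  case (node s s' t t' g)
  then show ?case by (metis eval_tree.simps(2) trees_on_Node)
next
  case (action s t u)
  then obtain B C where "Node Gen_m s t \<in> trees_on B" "u \<in> trees_on C" "B \<inter> C = {}"
    by (meson trees_on_Node)
  moreover then obtain B1 B2 where "t \<in> trees_on B2" "B = B1 \<union> B2"
    by (meson trees_on_Node)
  ultimately have "t \<in> trees_on B2" "u \<in> trees_on C" "B2 \<inter> C = {}" by auto
  then show ?case
    using triangle_action[OF eval_tree_trees_on eval_tree_trees_on, of t B2 u C] by simp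
qed (simp_all add: Un_ac)

section \<open>Normal forms of trees\<close>

text \<open>A triangle at the root of the right subtree gives its left argument to \<open>s\<close>,
  so \<open>s\<close> must vary in the induction while \<open>u\<close> shrinks.\<close>

lemma tree_equiv_triangle_normal:
  "\<exists>s' u'. Node Gen_triangle s u \<approx> Node Gen_triangle s' u' \<and> (\<forall>x y. u' \<noteq> Node Gen_triangle x y)"
proof (induction u arbitrary: s)
  case (Node g x y)
  show ?case
  proof (cases g)
    case Gen_triangle
    have "Node Gen_triangle s (Node Gen_triangle x y) \<approx> Node Gen_triangle (Node Gen_m s x) y"
      by (rule tree_equiv.sym[OF tree_equiv.action])
    then show ?thesis
      using Node.IH(2)[of "Node Gen_m s x"] tree_equiv.trans Gen_triangle by blast
  next
    case Gen_m
    show ?thesis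
      by (rule exI[of _ s], rule exI[of _ "Node g x y"]) (simp add: Gen_m tree_equiv.refl)
  qed
next
  case (Leaf a)
  then show ?case
    by (rule exI[of _ s], rule exI[of _ "Leaf a"]) (simp add: tree_equiv.refl)
qed

text \<open>Following one label singles out a summand of an iterated \<open>m\<close> without having
  to order the summands: commute and reassociate until \<open>a\<close> lies in a left summand whose
  root is not \<open>m\<close>.\<close>

lemma tree_equiv_split:
  assumes "a \<in> set (leaves (Node Gen_m s t))"
  shows "\<exists>s' t'. Node Gen_m s t \<approx> Node Gen_m s' t' \<and> a \<in> set (leaves s') \<and>
    (\<forall>x y. s' \<noteq> Node Gen_m x y)"
proof -
  \<comment> \<open>The induction needs a claim about every tree containing \<open>a\<close>: either
    it is itself such a summand, or it splits as required.\<close>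
  have "(\<forall>x y. u \<noteq> Node Gen_m x y) \<or> (\<exists>s' t'. u \<approx> Node Gen_m s' t' \<and> a \<in> set (leaves s') \<and>
    (\<forall>x y. s' \<noteq> Node Gen_m x y))" if "a \<in> set (leaves u)" for u
    using that
  proof (induction u)
    case (Node g s t)
    \<comment> \<open>The case of \<open>a\<close> in the left subtree; the other case is its mirror
      image under \<open>comm\<close>.\<close>
    have *: "\<exists>s' t'. Node Gen_m s t \<approx> Node Gen_m s' t' \<and> a \<in> set (leaves s') \<and>
      (\<forall>x y. s' \<noteq> Node Gen_m x y)" if a: "a \<in> set (leaves s)"
      and "(\<forall>x y. s \<noteq> Node Gen_m x y) \<or> (\<exists>s' t'. s \<approx> Node Gen_m s' t' \<and> a \<in> set (leaves s') \<and>
        (\<forall>x y. s' \<noteq> Node Gen_m x y))" for s t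
      using that(2)
    proof
      assume "\<forall>x y. s \<noteq> Node Gen_m x y"
      then show ?thesis using a tree_equiv.refl by blast
    next
      assume "\<exists>s' t'. s \<approx> Node Gen_m s' t' \<and> a \<in> set (leaves s') \<and> (\<forall>x y. s' \<noteq> Node Gen_m x y)"
      then obtain s' t' where s': "s \<approx> Node Gen_m s' t'" "a \<in> set (leaves s')" "\<forall>x y. s' \<noteq> Node Gen_m x y"
        by blast
      then have "Node Gen_m s t \<approx> Node Gen_m s' (Node Gen_m t' t)"
        by (meson tree_equiv.trans tree_equiv.node tree_equiv.refl tree_equiv.assoc)
      then show ?thesis using s' by blast
    qed
    show ?case
    proof (cases g)
      case Gen_m
      show ?thesis
      proof (cases "a \<in> set (leaves s)")
        case True
        then show ?thesis using * Node.IH(1) Gen_m by blast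
      next
        case False
        then have "a \<in> set (leaves t)" using Node.prems by simp
        then show ?thesis using *[of t s] Node.IH(2) Gen_m tree_equiv.trans tree_equiv.comm by blast
      qed
    qed simp
  qed simp
  from this[OF assms] show ?thesis by blast
qed

lemma connected_eval_tree:
  assumes "t \<in> trees_on A" "\<forall>x y. t \<noteq> Node Gen_m x y"
  shows "connected_poset (eval_tree t)"
proof (cases t)
  case (Leaf a)
  then show ?thesis by (simp add: connected_singleton)
next
  case (Node g x y)
  then have "g = Gen_triangle" using assms(2) by (cases g) auto
  then show ?thesis
    using assms(1) Node by (auto elim!: trees_on_Node intro!: connected_triangle eval_tree_trees_on)
qed

lemma not_connected_eval_tree:
  "Node Gen_m x y \<in> trees_on A \<Longrightarrow> \<not> connected_poset (eval_tree (Node Gen_m x y))"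
  by (elim trees_on_Node) (simp add: not_connected_union[OF eval_tree_trees_on eval_tree_trees_on])

text \<open>Such a tree gives a single point or a disconnected poset, and neither has an element
  strictly above all minimal ones. This supplies the last hypothesis of
  \<open>parts_triangle\<close>.\<close>

lemma AboveS_eval_tree:
  assumes "t \<in> trees_on A" "\<forall>x y. t \<noteq> Node Gen_triangle x y"
  shows "AboveS (eval_tree t) (min_elems (eval_tree t)) = {}"
proof (cases t)
  case (Leaf a)
  then show ?thesis by (simp add: AboveS_min_elems_singleton)
next
  case (Node g x y)
  then have g: "g = Gen_m" using assms(2) by (cases g) auto
  show ?thesis
    using not_connected_eval_tree assms(1) eval_tree_trees_on unfolding Node g
    by (intro AboveS_min_elems_disconnected) blast+
qed

lemma trees_on_length: "t \<in> trees_on A \<Longrightarrow> length (leaves t) = card A"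
  by (auto simp: trees_on_def distinct_card)

lemma trees_on_eval_unique: "\<lbrakk>t \<in> trees_on A; t' \<in> trees_on B; eval_tree t = eval_tree t'\<rbrakk> \<Longrightarrow> A = B"
  using eval_tree_trees_on Field_posets_on by metis

lemma trees_on_finite: "t \<in> trees_on A \<Longrightarrow> finite A \<and> A \<noteq> {}"
  using leaves_nonempty[of t] by (auto simp: trees_on_def)

text \<open>The value of \<open>s\<close> is connected because its root is not \<open>m\<close>, so
  \<open>B\<close> is the whole component of \<open>a\<close>. Hence the label set of the left
  summand depends on the poset and \<open>a\<close> alone.\<close>

lemma hasse_path_component:
  assumes s: "s \<in> trees_on B" "\<forall>x y. s \<noteq> Node Gen_m x y" and t: "t \<in> trees_on C"
    and BC: "B \<inter> C = {}" and a: "a \<in> B"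
  shows "hasse_path (eval_tree (Node Gen_m s t)) `` {a} = B"
proof -
  note s' = eval_tree_trees_on[OF s(1)] and t' = eval_tree_trees_on[OF t]
  have "hasse_path (eval_tree s) = B \<times> B"
    using connected_eval_tree[OF s] Field_posets_on[OF s'] by (simp add: connected_poset_def)
  moreover have "hasse_path (eval_tree t) \<subseteq> C \<times> C"
    using equiv_hasse_path[OF t'] equiv_type by blast
  ultimately show ?thesis
    using a BC by (auto simp: hasse_path_union[OF s' t' BC])
qed

text \<open>The induction is on the number of labels rather than on trees, because normalising
  replaces the subtrees by new ones.\<close>

lemma tree_equiv_complete:
  "\<lbrakk>t \<in> trees_on A; t' \<in> trees_on A; eval_tree t = eval_tree t'\<rbrakk> \<Longrightarrow> t \<approx> t'"
proof (induction "card A" arbitrary: A t t' rule: less_induct)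
  case less
  note IH = less.hyps and t = less.prems(1) and t' = less.prems(2) and eq = less.prems(3)
  show ?case
  proof (cases t)
    case (Leaf a)
    then have A: "A = {a}" using t by (simp add: trees_on_def)
    show ?thesis
    proof (cases t')
      case (Leaf b)
      then show ?thesis using \<open>t = Leaf a\<close> eq by (simp add: tree_equiv.refl)
    next
      case (Node g x y)
      \<comment> \<open>A node has at least two leaves, while \<open>A\<close> has one
        element.\<close>
      then have "length (leaves x) + length (leaves y) = 1"
        using trees_on_length[OF t'] A by simp
      then show ?thesis using leaves_nonempty[of x] leaves_nonempty[of y]
        by (simp add: add_is_1)
    qed
  next
    case (Node g x y)
    show ?thesis
    proof (cases g)
      case Gen_m
      have "\<not> connected_poset (eval_tree t')"
        using not_connected_eval_tree[of x y A] t eq Node Gen_m by simp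
      then obtain x' y' where t'': "t' = Node Gen_m x' y'"
        using connected_eval_tree[OF t'] by blast
      obtain a where a: "a \<in> A" using trees_on_finite[OF t] by blast
      have set: "set (leaves t) = A" "set (leaves t') = A" using t t' by (auto simp: trees_on_def)
      obtain s u where su: "t \<approx> Node Gen_m s u" "a \<in> set (leaves s)" "\<forall>x y. s \<noteq> Node Gen_m x y"
        using tree_equiv_split[of a x y] a set(1) unfolding Node Gen_m by blast
      obtain s' u' where su': "t' \<approx> Node Gen_m s' u'" "a \<in> set (leaves s')" "\<forall>x y. s' \<noteq> Node Gen_m x y"
        using tree_equiv_split[of a x' y'] a set(2) unfolding t'' by blast
      have on: "Node Gen_m s u \<in> trees_on A" "Node Gen_m s' u' \<in> trees_on A"
        using tree_equiv_trees_on su(1) su'(1) t t' by blast+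
      then obtain B C B' C' where B: "s \<in> trees_on B" "u \<in> trees_on C" "B \<inter> C = {}" "A = B \<union> C"
        and B': "s' \<in> trees_on B'" "u' \<in> trees_on C'" "B' \<inter> C' = {}" "A = B' \<union> C'"
        by (meson trees_on_Node)
      have eq': "eval_tree (Node Gen_m s u) = eval_tree (Node Gen_m s' u')"
        using eval_tree_equiv[OF su(1) t] eval_tree_equiv[OF su'(1) t'] eq by (simp only:)
      have aB: "a \<in> B" "a \<in> B'" using su(2) su'(2) B B' by (auto simp: trees_on_def)
      \<comment> \<open>Both are the component of \<open>a\<close> in the common poset.\<close>
      have "B = B'"
        using hasse_path_component[OF B(1) su(3) B(2,3) aB(1)]
          hasse_path_component[OF B'(1) su'(3) B'(2,3) aB(2)] unfolding eq' by simp
      moreover from this have "C = C'" using B(3,4) B'(3,4) by blast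
      ultimately have on': "s' \<in> trees_on B" "u' \<in> trees_on C" using B' by auto
      note sub = B(1,2)[THEN eval_tree_trees_on, THEN posets_on_subset]
        on'[THEN eval_tree_trees_on, THEN posets_on_subset]
      have un: "eval_tree s \<union> eval_tree u = eval_tree s' \<union> eval_tree u'" using eq' by simp
      \<comment> \<open>No relation joins \<open>B\<close> and \<open>C\<close>, so each summand is
        the part of the union over its own label set.\<close>
      have "eval_tree s = eval_tree s'" "eval_tree u = eval_tree u'"
        using un sub B(3) by blast+
      moreover have "card B < card A" "card C < card A"
        using trees_on_finite[OF B(1)] trees_on_finite[OF B(2)] B(3,4)
        by (auto intro!: psubset_card_mono)
      ultimately have "Node Gen_m s u \<approx> Node Gen_m s' u'"
        using IH B(1,2) on' by (intro tree_equiv.node) blast+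
      then show ?thesis using su(1) su'(1) tree_equiv.sym tree_equiv.trans by blast
    next
      case Gen_triangle
      have "connected_poset (eval_tree t')"
        using connected_eval_tree[OF t] eq unfolding Node Gen_triangle by simp
      then have "\<forall>x y. t' \<noteq> Node Gen_m x y" using not_connected_eval_tree t' by blast
      moreover have "t' \<noteq> Leaf b" for b
      proof
        assume b: "t' = Leaf b"
        then have "A = {b}" using t' by (simp add: trees_on_def)
        then have "length (leaves x) + length (leaves y) = 1"
          using trees_on_length[OF t] unfolding Node by simp
        then show False using leaves_nonempty[of x] leaves_nonempty[of y]
          by (simp add: add_is_1)
      qed
      ultimately obtain x' y' where t'': "t' = Node Gen_triangle x' y'"
        by (metis generator.exhaust tree.exhaust)
      obtain s u where su: "t \<approx> Node Gen_triangle s u" "\<forall>x y. u \<noteq> Node Gen_triangle x y"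
        using tree_equiv_triangle_normal unfolding Node Gen_triangle by blast
      obtain s' u' where su': "t' \<approx> Node Gen_triangle s' u'" "\<forall>x y. u' \<noteq> Node Gen_triangle x y"
        using tree_equiv_triangle_normal unfolding t'' by blast
      have on: "Node Gen_triangle s u \<in> trees_on A" "Node Gen_triangle s' u' \<in> trees_on A"
        using tree_equiv_trees_on su(1) su'(1) t t' by blast+
      then obtain B C B' C' where B: "s \<in> trees_on B" "u \<in> trees_on C" "B \<inter> C = {}" "A = B \<union> C"
        and B': "s' \<in> trees_on B'" "u' \<in> trees_on C'" "B' \<inter> C' = {}" "A = B' \<union> C'"
        by (meson trees_on_Node)
      have "eval_tree (Node Gen_triangle s u) = eval_tree (Node Gen_triangle s' u')"
        using eval_tree_equiv[OF su(1) t] eval_tree_equiv[OF su'(1) t'] eq by (simp only:)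
      \<comment> \<open>Neither right subtree has a triangle at its root, so the parts of the common
        poset are the values of the subtrees on both sides.\<close>
      then have eq': "eval_tree s = eval_tree s'" "eval_tree u = eval_tree u'"
        using parts_triangle[OF B(1,2)[THEN eval_tree_trees_on] B(3) AboveS_eval_tree[OF B(2) su(2)]]
          parts_triangle[OF B'(1,2)[THEN eval_tree_trees_on] B'(3) AboveS_eval_tree[OF B'(2) su'(2)]]
        by simp_all
      have on': "s' \<in> trees_on B" "u' \<in> trees_on C"
        using trees_on_eval_unique B(1,2) B'(1,2) eq' by metis+
      moreover have "card B < card A" "card C < card A"
        using trees_on_finite[OF B(1)] trees_on_finite[OF B(2)] B(3,4)
        by (auto intro!: psubset_card_mono)
      ultimately have "Node Gen_triangle s u \<approx> Node Gen_triangle s' u'"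
        using IH B(1,2) eq' by (intro tree_equiv.node) blast+
      then show ?thesis using su(1) su'(1) tree_equiv.sym tree_equiv.trans by blast
    qed
  qed
qed

section \<open>The presentation\<close>

lemma free_operad_sel [simp]:
  "smult free_operad = scale"
  "component free_operad = (\<lambda>A. {p. Poly_Mapping.keys p \<subseteq> trees_on A})"
  "relabel free_operad = (\<lambda>\<sigma>. lin (map_tree id \<sigma>))"
  "pcomp free_operad = (\<lambda>a. bilin (graft a))"
  "ounit free_operad = (\<lambda>a. basis (Leaf a))"
  by (simp_all add: free_operad_def)

text \<open>From here on compatibility enters only through the trees that evaluate to compatible
  posets.\<close>

lemma CP_eq: "CP A = {p :: nat rel \<Rightarrow>\<^sub>0 'k::field. Poly_Mapping.keys p \<subseteq> eval_tree ` trees_on A}"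
  by (simp add: CP_def compatible_posets_eq span_basis)

lemma CP_operad_sel [simp]:
  "smult CP_operad = scale"
  "component CP_operad = CP"
  "relabel CP_operad = (\<lambda>\<sigma>. lin (\<lambda>r. map_prod \<sigma> \<sigma> ` r))"
  "pcomp CP_operad = (\<lambda>a. bilin (poset_comp a))"
  "ounit CP_operad = (\<lambda>a. basis {(a, a)})"
  by (simp_all add: CP_operad_def)

lemma eval_tree_relabel_trees_on:
  "\<lbrakk>t \<in> trees_on A; bij_betw \<sigma> A B\<rbrakk> \<Longrightarrow> map_prod \<sigma> \<sigma> ` eval_tree t = eval_tree (map_tree id \<sigma> t)"
  by (auto simp: trees_on_def bij_betw_def eval_tree_relabel)

lemma eval_tree_graft_trees_on:
  "\<lbrakk>t \<in> trees_on A; u \<in> trees_on B; A \<inter> B = {}; a \<in> A\<rbrakk>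
    \<Longrightarrow> poset_comp a (eval_tree t) (eval_tree u) = eval_tree (graft a t u)"
  by (auto simp: trees_on_def eval_tree_graft)

lemma CP_relabel_closed:
  assumes "bij_betw \<sigma> A B" "x \<in> CP A"
  shows "lin (\<lambda>r. map_prod \<sigma> \<sigma> ` r) x \<in> CP B"
  using assms(2) unfolding CP_eq mem_Collect_eq
  by (rule keys_lin_subset) (auto simp: eval_tree_relabel_trees_on[OF _ assms(1)] map_tree_trees_on[OF _ assms(1)])

text \<open>Choosing trees for two compatible posets turns their composition into grafting, and the
  grafted tree certifies that the composite is compatible.\<close>

lemma CP_pcomp_closed:
  assumes "A \<inter> B = {}" "a \<in> A" "x \<in> CP A" "y \<in> CP B"
  shows "bilin (poset_comp a) x y \<in> CP ((A - {a}) \<union> B)"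
  using assms(3,4) unfolding CP_eq mem_Collect_eq
  by (rule keys_bilin_subset)
    (auto simp: eval_tree_graft_trees_on[OF _ _ assms(1,2)] graft_trees_on[OF _ _ assms(1,2)])

lemma suboperadD:
  assumes "suboperad P S"
  shows "label_set A \<Longrightarrow> module.subspace (smult P) (S A)"
    and "\<lbrakk>label_set A; bij_betw \<sigma> A B; x \<in> S A\<rbrakk> \<Longrightarrow> relabel P \<sigma> x \<in> S B"
    and "ounit P a \<in> S {a}"
    and "\<lbrakk>label_set A; label_set B; A \<inter> B = {}; a \<in> A; x \<in> S A; y \<in> S B\<rbrakk>
      \<Longrightarrow> pcomp P a x y \<in> S ((A - {a}) \<union> B)"
proof -
  note S = assms[unfolded suboperad_def, THEN conjunct2]
  show "label_set A \<Longrightarrow> module.subspace (smult P) (S A)"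
    using S[THEN conjunct1] by blast
  note S = S[THEN conjunct2]
  show "\<lbrakk>label_set A; bij_betw \<sigma> A B; x \<in> S A\<rbrakk> \<Longrightarrow> relabel P \<sigma> x \<in> S B"
    using S[THEN conjunct1] by blast
  note S = S[THEN conjunct2]
  show "ounit P a \<in> S {a}"
    using S[THEN conjunct1] by blast
  show "\<lbrakk>label_set A; label_set B; A \<inter> B = {}; a \<in> A; x \<in> S A; y \<in> S B\<rbrakk>
      \<Longrightarrow> pcomp P a x y \<in> S ((A - {a}) \<union> B)"
    using S[THEN conjunct2] by blast
qed

lemma operadic_idealD:
  assumes "operadic_ideal P J"
  shows "label_set A \<Longrightarrow> module.subspace (smult P) (J A)"
    and "\<lbrakk>label_set A; bij_betw \<sigma> A B; x \<in> J A\<rbrakk> \<Longrightarrow> relabel P \<sigma> x \<in> J B"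
    and "\<lbrakk>label_set A; label_set B; A \<inter> B = {}; a \<in> A; x \<in> J A; y \<in> component P B\<rbrakk>
      \<Longrightarrow> pcomp P a x y \<in> J ((A - {a}) \<union> B)"
    and "\<lbrakk>label_set A; label_set B; A \<inter> B = {}; a \<in> A; x \<in> component P A; y \<in> J B\<rbrakk>
      \<Longrightarrow> pcomp P a x y \<in> J ((A - {a}) \<union> B)"
proof -
  note J = assms[unfolded operadic_ideal_def]
  show "label_set A \<Longrightarrow> module.subspace (smult P) (J A)"
    using J[THEN conjunct1] by blast
  note J = J[THEN conjunct2]
  show "\<lbrakk>label_set A; bij_betw \<sigma> A B; x \<in> J A\<rbrakk> \<Longrightarrow> relabel P \<sigma> x \<in> J B"
    using J[THEN conjunct1] by blast
  show "\<lbrakk>label_set A; label_set B; A \<inter> B = {}; a \<in> A; x \<in> J A; y \<in> component P B\<rbrakk>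
      \<Longrightarrow> pcomp P a x y \<in> J ((A - {a}) \<union> B)"
    and "\<lbrakk>label_set A; label_set B; A \<inter> B = {}; a \<in> A; x \<in> component P A; y \<in> J B\<rbrakk>
      \<Longrightarrow> pcomp P a x y \<in> J ((A - {a}) \<union> B)"
    using J[THEN conjunct2, THEN spec[of _ A], THEN spec[of _ B], THEN spec[of _ a]] by blast+
qed

lemma operad_morphismD:
  assumes "operad_morphism P Q \<phi>"
  shows "\<lbrakk>label_set A; bij_betw \<sigma> A B; x \<in> component P A\<rbrakk>
      \<Longrightarrow> \<phi> (relabel P \<sigma> x) = relabel Q \<sigma> (\<phi> x)"
    and "\<lbrakk>label_set A; label_set B; A \<inter> B = {}; a \<in> A; x \<in> component P A; y \<in> component P B\<rbrakk>
      \<Longrightarrow> \<phi> (pcomp P a x y) = pcomp Q a (\<phi> x) (\<phi> y)"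
proof -
  note \<phi> = assms[unfolded operad_morphism_def, THEN conjunct2]
  show "\<lbrakk>label_set A; bij_betw \<sigma> A B; x \<in> component P A\<rbrakk>
      \<Longrightarrow> \<phi> (relabel P \<sigma> x) = relabel Q \<sigma> (\<phi> x)"
    using \<phi>[THEN conjunct1] by blast
  show "\<lbrakk>label_set A; label_set B; A \<inter> B = {}; a \<in> A; x \<in> component P A; y \<in> component P B\<rbrakk>
      \<Longrightarrow> \<phi> (pcomp P a x y) = pcomp Q a (\<phi> x) (\<phi> y)"
    using \<phi>[THEN conjunct2, THEN conjunct2] by blast
qed

lemma suboperad_CP: "suboperad poset_operad (CP :: nat set \<Rightarrow> (nat rel \<Rightarrow>\<^sub>0 'k::field) set)"
proof -
  have "CP A \<subseteq> {p :: nat rel \<Rightarrow>\<^sub>0 'k. Poly_Mapping.keys p \<subseteq> posets_on A}" for A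
    using eval_tree_trees_on by (fastforce simp: CP_eq)
  moreover have "scale.subspace (CP A :: (nat rel \<Rightarrow>\<^sub>0 'k) set)" for A
    by (simp add: CP_eq subspace_keys_subset)
  moreover have "basis {(a, a)} \<in> (CP {a} :: (nat rel \<Rightarrow>\<^sub>0 'k) set)" for a
    by (auto simp: CP_eq trees_on_def intro!: image_eqI[of _ _ "Leaf a"])
  ultimately show ?thesis
    unfolding suboperad_def poset_operad_sel
    by (intro conjI allI impI ballI operad_poset_operad) (blast intro: CP_relabel_closed CP_pcomp_closed)+
qed

section \<open>Generation by the two binary posets\<close>

lemma ex_fresh_label:
  fixes A :: "nat set"
  assumes "finite A"
  obtains a where "a \<notin> A"
  using assms ex_new_if_finite infinite_UNIV_nat by blast

lemma Leaf_trees_on: "Leaf a \<in> trees_on {a}"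
  by (simp add: trees_on_def)

lemma Node_trees_on:
  "\<lbrakk>s \<in> trees_on A; t \<in> trees_on B; A \<inter> B = {}\<rbrakk> \<Longrightarrow> Node g s t \<in> trees_on (A \<union> B)"
  by (auto simp: trees_on_def)

lemma graft_idle_trees_on: "\<lbrakk>t \<in> trees_on A; a \<notin> A\<rbrakk> \<Longrightarrow> graft a t u = t"
  by (simp add: trees_on_def)

lemma eval_generator: "eval_tree (Node g (Leaf 1) (Leaf 2)) = gen_poset g"
  by (cases g) (auto simp: poset_triangle_def min_elems_singleton)

text \<open>A node is built by two insertions: the generator is moved to fresh labels
  \<open>b\<close> and \<open>c\<close>, which the two subtrees then replace in turn. Freshness
  keeps the label sets disjoint throughout.\<close>

lemma basis_eval_tree_in_suboperad:
  fixes S :: "nat set \<Rightarrow> (nat rel \<Rightarrow>\<^sub>0 'k::field) set"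
  assumes S: "suboperad poset_operad S" and gen: "\<And>g. basis (gen_poset g) \<in> S {1, 2}"
    and "t \<in> trees_on A"
  shows "basis (eval_tree t) \<in> S A"
  using assms(3)
proof (induction t arbitrary: A)
  case (Leaf a)
  then show ?case using suboperadD(3)[OF S] by (auto simp: trees_on_def)
next
  case (Node g s t)
  then obtain B C where s: "s \<in> trees_on B" and t: "t \<in> trees_on C" and BC: "B \<inter> C = {}" "A = B \<union> C"
    by (elim trees_on_Node)
  note fin = trees_on_finite[OF s] trees_on_finite[OF t]
  have comp: "basis (poset_comp a p q) \<in> S ((A - {a}) \<union> B)"
    if "basis p \<in> S A" "basis q \<in> S B" "label_set A" "label_set B" "A \<inter> B = {}" "a \<in> A" for A B a p q
  proof -
    have "bilin (poset_comp a) (basis p) (basis q) \<in> S ((A - {a}) \<union> B)"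
      using suboperadD(4)[OF S that(3-6,1,2)] by simp
    then show ?thesis by simp
  qed
  obtain b where b: "b \<notin> B \<union> C" using fin by (meson ex_fresh_label finite_UnI)
  obtain c where c: "c \<notin> insert b (B \<union> C)" using fin by (meson ex_fresh_label finite_UnI finite_insert)
  \<comment> \<open>The generators live on \<open>{1, 2}\<close>, so the value away from these
    labels is a mere default.\<close>
  define \<sigma> where "\<sigma> = (\<lambda>i::nat. if i = 1 then b else c)"
  have bij: "bij_betw \<sigma> {1, 2} {b, c}" using c by (auto simp: bij_betw_def \<sigma>_def)
  let ?n = "Node g (Leaf b) (Leaf c)"
  have n: "?n \<in> trees_on {b, c}" using c by (simp add: trees_on_def)
  have "lin (\<lambda>r. map_prod \<sigma> \<sigma> ` r) (basis (gen_poset g)) \<in> S {b, c}"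
    using suboperadD(2)[OF S _ bij gen[of g]] by simp
  moreover have "Node g (Leaf 1) (Leaf 2) \<in> trees_on {1, 2 :: nat}" by (simp add: trees_on_def)
  then have "map_prod \<sigma> \<sigma> ` gen_poset g = eval_tree ?n"
    using eval_tree_relabel_trees_on[OF _ bij, of "Node g (Leaf 1) (Leaf 2)"]
    by (simp only: eval_generator) (simp add: \<sigma>_def)
  ultimately have "basis (eval_tree ?n) \<in> S {b, c}" by simp
  moreover have "basis (eval_tree s) \<in> S B" "basis (eval_tree t) \<in> S C"
    using Node.IH s t by blast+
  ultimately have 1: "basis (poset_comp b (eval_tree ?n) (eval_tree s)) \<in> S (({b, c} - {b}) \<union> B)"
    using b c fin by (intro comp) auto
  \<comment> \<open>The label \<open>c\<close> survives the first insertion and becomes the point of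
    the second.\<close>
  have bB: "({b, c} - {b}) \<union> B = insert c B" using b c by auto
  have disj: "{b, c} \<inter> B = {}" using b c by auto
  have ns: "graft b ?n s = Node g s (Leaf c)" using c by simp
  have 2: "Node g s (Leaf c) \<in> trees_on (insert c B)"
    using graft_trees_on[OF n s disj, of b] unfolding ns bB by simp
  have "poset_comp b (eval_tree ?n) (eval_tree s) = eval_tree (Node g s (Leaf c))"
    using eval_tree_graft_trees_on[OF n s disj, of b] unfolding ns by simp
  with 1 bB have "basis (eval_tree (Node g s (Leaf c))) \<in> S (insert c B)" by simp
  then have 3: "basis (poset_comp c (eval_tree (Node g s (Leaf c))) (eval_tree t)) \<in> S ((insert c B - {c}) \<union> C)"
    using \<open>basis (eval_tree t) \<in> S C\<close> BC c fin by (intro comp) auto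
  have "insert c B - {c} = B" using c by auto
  moreover have nt: "graft c (Node g s (Leaf c)) t = Node g s t"
    using graft_idle_trees_on[OF s] c by simp
  have "poset_comp c (eval_tree (Node g s (Leaf c))) (eval_tree t) = eval_tree (Node g s t)"
    using eval_tree_graft_trees_on[OF 2 t, of c] BC c unfolding nt by simp
  ultimately show ?case using 3 BC by simp
qed

lemma generated_suboperad_CP:
  assumes "label_set A"
  shows "generated_suboperad poset_operad {basis (gen_poset Gen_m), basis (gen_poset Gen_triangle)} A
    = (CP A :: (nat rel \<Rightarrow>\<^sub>0 'k::field) set)"
proof
  let ?X = "{basis (gen_poset Gen_m), basis (gen_poset Gen_triangle)} :: (nat rel \<Rightarrow>\<^sub>0 'k) set"
  have gen: "Node g (Leaf 1) (Leaf 2) \<in> trees_on {1, 2 :: nat}" for g :: generator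
    by (simp add: trees_on_def)
  have pos: "gen_poset g \<in> posets_on {1, 2}" for g
    using eval_tree_trees_on[OF gen[of g]] by (simp only: eval_generator)
  have CP_gen: "basis (gen_poset g) \<in> (CP {1, 2} :: (nat rel \<Rightarrow>\<^sub>0 'k) set)" for g
    using gen[of g] eval_generator[of g] unfolding CP_eq by (metis (no_types, lifting) empty_subsetI
        image_eqI insert_subset keys_basis mem_Collect_eq)
  \<comment> \<open>The field of a poset determines its label set, so a generator lies in no
    component other than that on \<open>{1, 2}\<close>, and the condition at every \<open>B\<close>
    reduces to this one.\<close>
  have B: "B = {1, 2}" if "gen_poset g \<in> posets_on B" for g and B :: "nat set"
    using Field_posets_on[OF that] Field_posets_on[OF pos[of g]] by simp
  have "?X \<inter> component poset_operad B \<subseteq> CP B" for B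
    using CP_gen B by (auto simp del: gen_poset.simps)
  then show "generated_suboperad poset_operad ?X A \<subseteq> CP A"
    using suboperad_CP unfolding generated_suboperad_def by blast
  show "CP A \<subseteq> generated_suboperad poset_operad ?X A"
    unfolding generated_suboperad_def
  proof (intro Inter_greatest, clarify)
    fix S :: "nat set \<Rightarrow> (nat rel \<Rightarrow>\<^sub>0 'k) set" and x :: "nat rel \<Rightarrow>\<^sub>0 'k"
    assume S: "suboperad poset_operad S"
      and X: "\<forall>B. label_set B \<longrightarrow> ?X \<inter> component poset_operad B \<subseteq> S B"
      and x: "x \<in> CP A"
    have "basis (gen_poset g) \<in> S {1, 2}" for g
    proof -
      have "?X \<inter> component poset_operad {1, 2} \<subseteq> S {1, 2}" using X by simp
      moreover have "basis (gen_poset g) \<in> ?X \<inter> component poset_operad {1, 2}"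
        using pos[of g] by (cases g) auto
      ultimately show ?thesis by blast
    qed
    then have "basis ` eval_tree ` trees_on A \<subseteq> S A"
      using basis_eval_tree_in_suboperad[OF S] by blast
    moreover have "scale.subspace (S A)"
      using suboperadD(1)[OF S assms] by simp
    ultimately have "scale.span (basis ` eval_tree ` trees_on A) \<subseteq> S A"
      by (rule scale.span_minimal)
    then show "x \<in> S A" using x by (auto simp: CP_eq span_basis)
  qed
qed

section \<open>The relations and the kernel of evaluation\<close>

text \<open>Inserting at \<open>1\<close> gives a left comb and inserting at \<open>2\<close> a
  right comb on the labels \<open>1\<close>, \<open>2\<close>, \<open>3\<close>; these are the tree
  shapes in \<open>assoc\<close> and \<open>action\<close>.\<close>

lemma CP_relations_eq:
  fixes R :: "((generator, nat) tree \<Rightarrow>\<^sub>0 'k::field) set"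
  defines "R \<equiv> {basis (Node Gen_m (Leaf 2) (Leaf 1)) - basis (Node Gen_m (Leaf 1) (Leaf 2)),
    basis (Node Gen_m (Node Gen_m (Leaf 1) (Leaf 2)) (Leaf 3))
      - basis (Node Gen_m (Leaf 1) (Node Gen_m (Leaf 2) (Leaf 3))),
    basis (Node Gen_triangle (Node Gen_m (Leaf 1) (Leaf 2)) (Leaf 3))
      - basis (Node Gen_triangle (Leaf 1) (Node Gen_triangle (Leaf 2) (Leaf 3)))}"
  shows "CP_relations = R"
  by (simp add: CP_relations_def R_def free_generator_def numbered_pcomp_def Let_def eval_nat_numeral)

lemma operad_morphism_lin_eval_tree:
  "operad_morphism (free_operad :: ('k::field, (generator, nat) tree \<Rightarrow>\<^sub>0 'k) operad_data)
    CP_operad (lin eval_tree)"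
proof -
  have closed: "lin eval_tree x \<in> CP A" if "Poly_Mapping.keys x \<subseteq> trees_on A"
    for A and x :: "(generator, nat) tree \<Rightarrow>\<^sub>0 'k"
    using keys_lin_subset[OF that order_refl] by (simp add: CP_eq)
  have relabel: "lin eval_tree (lin (map_tree id \<sigma>) x) = lin (\<lambda>r. map_prod \<sigma> \<sigma> ` r) (lin eval_tree x)"
    if "bij_betw \<sigma> A B" "Poly_Mapping.keys x \<subseteq> trees_on A"
    for \<sigma> A B and x :: "(generator, nat) tree \<Rightarrow>\<^sub>0 'k"
    unfolding lin_lin
    by (rule lin_cong[OF that(2)]) (simp add: eval_tree_relabel_trees_on[OF _ that(1)])
  have comp: "lin eval_tree (bilin (graft a) x y) = bilin (poset_comp a) (lin eval_tree x) (lin eval_tree y)"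
    if d: "A \<inter> B = {}" "a \<in> A" and x: "Poly_Mapping.keys x \<subseteq> trees_on A"
      and y: "Poly_Mapping.keys y \<subseteq> trees_on B"
    for A B a and x y :: "(generator, nat) tree \<Rightarrow>\<^sub>0 'k"
    using x
  proof (induction x rule: free_induct)
    case (basis s)
    show ?case
      unfolding lin_basis bilin_basis_left lin_lin
      by (rule lin_cong[OF y]) (simp add: eval_tree_graft_trees_on[OF basis _ d])
  qed (simp_all add: multilinear)
  show ?thesis
    unfolding operad_morphism_def free_operad_sel CP_operad_sel mem_Collect_eq
    by (intro conjI allI impI ballI) (auto simp: lin_add lin_scale intro: closed relabel comp)
qed

lemma relation_in_kernel:
  assumes "s \<approx> t" "s \<in> trees_on A"
  shows "lin eval_tree (basis s - basis t :: (generator, nat) tree \<Rightarrow>\<^sub>0 'k::field) = 0"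
  using eval_tree_equiv[OF assms] by (simp add: lin_diff)

text \<open>The kernel of a morphism is an operadic ideal, and it contains the relations because
  each is an instance of \<open>tree_equiv\<close>; minimality of the generated ideal does the
  rest.\<close>

lemma generated_ideal_subset_kernel:
  assumes A: "label_set A"
  shows "generated_ideal free_operad (CP_relations :: ((generator, nat) tree \<Rightarrow>\<^sub>0 'k::field) set) A
    \<subseteq> {x \<in> component free_operad A. lin eval_tree x = 0}"
proof -
  define K where "K A = {x :: (generator, nat) tree \<Rightarrow>\<^sub>0 'k. Poly_Mapping.keys x \<subseteq> trees_on A \<and> lin eval_tree x = 0}" for A
  note mor = operad_morphism_lin_eval_tree[where 'k='k]
  have K_keys: "K A \<subseteq> {x. Poly_Mapping.keys x \<subseteq> trees_on A}" for A
    by (auto simp: K_def)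
  have K_subspace: "scale.subspace (K A)" for A
    by (simp add: K_def scale.subspace_def keys_add_subset keys_scale_subset lin_add lin_scale)
  have K_relabel: "lin (map_tree id \<sigma>) x \<in> K B" if "label_set A" "bij_betw \<sigma> A B" "x \<in> K A" for A B \<sigma> x
  proof -
    have "Poly_Mapping.keys (lin (map_tree id \<sigma>) x) \<subseteq> trees_on B"
      using that(3) map_tree_trees_on[OF _ that(2)] by (intro keys_lin_subset[of x "trees_on A"]) (auto simp: K_def)
    then show ?thesis using that operad_morphismD(1)[OF mor, of A \<sigma> B x] by (simp add: K_def)
  qed
  \<comment> \<open>Both kinds of ideal closure at once: a composite is mapped to zero as soon as
    one factor is.\<close>
  have K_pcomp: "bilin (graft a) x y \<in> K ((A - {a}) \<union> B)"
    if AB: "label_set A" "label_set B" "A \<inter> B = {}" "a \<in> A"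
      and xy: "Poly_Mapping.keys x \<subseteq> trees_on A" "Poly_Mapping.keys y \<subseteq> trees_on B" "x \<in> K A \<or> y \<in> K B"
    for A B a x y
  proof -
    have "Poly_Mapping.keys (bilin (graft a) x y) \<subseteq> trees_on ((A - {a}) \<union> B)"
      using graft_trees_on[OF _ _ AB(3,4)] by (intro keys_bilin_subset[OF xy(1,2)])
    moreover have "lin eval_tree (bilin (graft a) x y)
        = bilin (poset_comp a) (lin eval_tree x) (lin eval_tree y)"
      using operad_morphismD(2)[OF mor AB, of x y] xy(1,2) by simp
    ultimately show ?thesis using xy(3) by (auto simp: K_def)
  qed
  have "operadic_ideal free_operad K"
    unfolding operadic_ideal_def free_operad_sel mem_Collect_eq
  proof (intro conjI allI impI ballI, goal_cases)
    case (3 A B \<sigma> x)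
    then show ?case using K_relabel by blast
  next
    case (4 A B a x y)
    then show ?case using K_pcomp[of A B a x y] K_keys by blast
  next
    case (5 A B a x y)
    then show ?case using K_pcomp[of A B a x y] K_keys by blast
  qed (simp_all add: K_keys K_subspace)
  moreover have "CP_relations \<inter> component free_operad B \<subseteq> K B" for B
  proof -
    have "lin eval_tree x = 0" if "x \<in> (CP_relations :: ((generator, nat) tree \<Rightarrow>\<^sub>0 'k) set)" for x
    proof -
      have "lin eval_tree (basis (Node Gen_m (Leaf 2) (Leaf (1 :: nat))) - basis (Node Gen_m (Leaf (1 :: nat)) (Leaf 2))) = (0 :: nat rel \<Rightarrow>\<^sub>0 'k)"
        by (rule relation_in_kernel[OF tree_equiv.comm, of _ _ "{1, 2}"]) (auto simp: trees_on_def)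
      moreover have "lin eval_tree (basis (Node Gen_m (Node Gen_m (Leaf (1 :: nat)) (Leaf 2)) (Leaf 3))
          - basis (Node Gen_m (Leaf (1 :: nat)) (Node Gen_m (Leaf 2) (Leaf 3)))) = (0 :: nat rel \<Rightarrow>\<^sub>0 'k)"
        by (rule relation_in_kernel[OF tree_equiv.assoc, of _ _ _ "{1, 2, 3}"]) (auto simp: trees_on_def)
      moreover have "lin eval_tree (basis (Node Gen_triangle (Node Gen_m (Leaf (1 :: nat)) (Leaf 2)) (Leaf 3))
          - basis (Node Gen_triangle (Leaf (1 :: nat)) (Node Gen_triangle (Leaf 2) (Leaf 3)))) = (0 :: nat rel \<Rightarrow>\<^sub>0 'k)"
        by (rule relation_in_kernel[OF tree_equiv.action, of _ _ _ "{1, 2, 3}"]) (auto simp: trees_on_def)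
      ultimately show ?thesis using that unfolding CP_relations_eq by blast
    qed
    then show ?thesis by (auto simp: K_def)
  qed
  ultimately have "generated_ideal free_operad CP_relations A \<subseteq> K A"
    unfolding generated_ideal_def by (intro Inter_lower) blast
  then show ?thesis by (simp add: K_def)
qed


text \<open>Ideals speak of linear combinations; bilinearity recasts their closure as rules for
  pairs of trees.\<close>

lemma basis_diff_graft_in_ideal:
  fixes J :: "nat set \<Rightarrow> (('g, nat) tree \<Rightarrow>\<^sub>0 'k::field) set"
  assumes J: "operadic_ideal free_operad J" and AB: "label_set A" "label_set B" "A \<inter> B = {}" "a \<in> A"
  shows "\<lbrakk>basis t - basis t' \<in> J A; u \<in> trees_on B\<rbrakk>
      \<Longrightarrow> basis (graft a t u) - basis (graft a t' u) \<in> J ((A - {a}) \<union> B)"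
    and "\<lbrakk>t \<in> trees_on A; basis u - basis u' \<in> J B\<rbrakk>
      \<Longrightarrow> basis (graft a t u) - basis (graft a t u') \<in> J ((A - {a}) \<union> B)"
proof -
  show "basis (graft a t u) - basis (graft a t' u) \<in> J ((A - {a}) \<union> B)"
    if "basis t - basis t' \<in> J A" "u \<in> trees_on B"
  proof -
    have "bilin (graft a) (basis t - basis t') (basis u) \<in> J ((A - {a}) \<union> B)"
      using operadic_idealD(3)[OF J AB that(1), of "basis u"] that(2) by simp
    then show ?thesis by (simp add: bilin_diff_left)
  qed
  show "basis (graft a t u) - basis (graft a t u') \<in> J ((A - {a}) \<union> B)"
    if "t \<in> trees_on A" "basis u - basis u' \<in> J B"
  proof -
    have "bilin (graft a) (basis t) (basis u - basis u') \<in> J ((A - {a}) \<union> B)"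
      using operadic_idealD(4)[OF J AB _ that(2), of "basis t"] that(1) by simp
    then show ?thesis by (simp add: lin_diff)
  qed
qed

text \<open>A difference of trees in \<open>J\<close> plays the part of a rewrite. Substitution of
  trees for labels and closure under contexts are both realised by grafting at fresh labels.\<close>

lemma tree_equiv_in_ideal:
  fixes J :: "nat set \<Rightarrow> ((generator, nat) tree \<Rightarrow>\<^sub>0 'k::field) set"
  assumes J: "operadic_ideal free_operad J"
    and rel: "\<And>B. label_set B \<Longrightarrow> CP_relations \<inter> component free_operad B \<subseteq> J B"
    and "s \<approx> t" "s \<in> trees_on A"
  shows "basis s - basis t \<in> J A"
proof -
  have J_subspace: "scale.subspace (J A)" if "label_set A" for A
    using operadic_idealD(1)[OF J that] by simp
  have add: "x + y \<in> J A" if "label_set A" "x \<in> J A" "y \<in> J A" for A x y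
    using scale.subspace_add[OF J_subspace] that by blast
  have relabel: "basis (map_tree id \<sigma> s) - basis (map_tree id \<sigma> t) \<in> J B"
    if "label_set A" "bij_betw \<sigma> A B" "basis s - basis t \<in> J A" for A B \<sigma> s t
  proof -
    have "lin (map_tree id \<sigma>) (basis s - basis t) \<in> J B"
      using operadic_idealD(2)[OF J that] by simp
    then show ?thesis by (simp add: lin_diff)
  qed
  have rel': "x \<in> J B" if "x \<in> CP_relations" "Poly_Mapping.keys x \<subseteq> trees_on B" "label_set B" for x B
    using rel[OF that(3)] that(1,2) by auto
  have keys_diff: "Poly_Mapping.keys (basis s - basis t :: (generator, nat) tree \<Rightarrow>\<^sub>0 'k) \<subseteq> trees_on B"
    if "s \<in> trees_on B" "t \<in> trees_on B" for s t B
    using keys_diff[of "basis s" "basis t"] that by auto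
  note graft_left = basis_diff_graft_in_ideal(1)[OF J] and graft_right = basis_diff_graft_in_ideal(2)[OF J]
  \<comment> \<open>Associativity and the third relation both equate a left comb with a right comb,
    so one argument with variable decorations handles both.\<close>
  have three: "basis (Node g (Node g' s t) u) - basis (Node h s (Node h' t u)) \<in> J A"
    if R: "basis (Node g (Node g' (Leaf 1) (Leaf 2)) (Leaf 3))
        - basis (Node h (Leaf 1) (Node h' (Leaf 2) (Leaf 3))) \<in> J {1, 2, 3}"
      and on: "Node g (Node g' s t) u \<in> trees_on A" for g g' h h' s t u A
  proof -
    define B C D where BCD: "B = set (leaves s)" "C = set (leaves t)" "D = set (leaves u)"
    then have s: "s \<in> trees_on B" and t: "t \<in> trees_on C" and u: "u \<in> trees_on D"
      and d: "B \<inter> C = {}" "B \<inter> D = {}" "C \<inter> D = {}" and A: "A = B \<union> C \<union> D"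
      using on by (auto simp: trees_on_def)
    note fin = trees_on_finite[OF s] trees_on_finite[OF t] trees_on_finite[OF u]
    have finA: "finite A" using fin A by simp
    \<comment> \<open>\<open>p\<close>, \<open>q\<close> and \<open>w\<close> avoid all of
      \<open>A\<close>, so after each insertion the tree to be inserted next is still disjoint from
      the labels present.\<close>
    then obtain p where p: "p \<notin> A" by (rule ex_fresh_label)
    obtain q where q: "q \<notin> insert p A" using finA by (meson ex_fresh_label finite_insert)
    obtain w where w: "w \<notin> insert q (insert p A)" using finA by (meson ex_fresh_label finite_insert)
    define \<sigma> where "\<sigma> = (\<lambda>i::nat. if i = 1 then p else if i = 2 then q else w)"
    have bij: "bij_betw \<sigma> {1, 2, 3} {p, q, w}" using q w by (auto simp: bij_betw_def \<sigma>_def)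
    from relabel[OF _ bij R]
    have "basis (Node g (Node g' (Leaf p) (Leaf q)) (Leaf w))
        - basis (Node h (Leaf p) (Node h' (Leaf q) (Leaf w))) \<in> J {p, q, w}"
      by (simp add: \<sigma>_def)
    from graft_left[OF _ _ _ _ this s, of p]
    have 1: "basis (Node g (Node g' s (Leaf q)) (Leaf w))
        - basis (Node h s (Node h' (Leaf q) (Leaf w))) \<in> J (({p, q, w} - {p}) \<union> B)"
      using p q w fin A by simp
    have "({p, q, w} - {p}) \<union> B = insert q (insert w B)" using p q w by auto
    with 1 have 2: "basis (Node g (Node g' s (Leaf q)) (Leaf w))
        - basis (Node h s (Node h' (Leaf q) (Leaf w))) \<in> J (insert q (insert w B))" by simp
    from graft_left[OF _ _ _ _ 2 t, of q]
    have 3: "basis (Node g (Node g' s t) (Leaf w)) - basis (Node h s (Node h' t (Leaf w)))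
        \<in> J ((insert q (insert w B) - {q}) \<union> C)"
      using q w fin A d by (simp add: graft_idle_trees_on[OF s])
    have "(insert q (insert w B) - {q}) \<union> C = insert w (B \<union> C)" using q w A by auto
    with 3 have 4: "basis (Node g (Node g' s t) (Leaf w)) - basis (Node h s (Node h' t (Leaf w)))
        \<in> J (insert w (B \<union> C))" by simp
    from graft_left[OF _ _ _ _ 4 u, of w]
    have 5: "basis (Node g (Node g' s t) u) - basis (Node h s (Node h' t u))
        \<in> J ((insert w (B \<union> C) - {w}) \<union> D)"
      using w fin A d by (simp add: graft_idle_trees_on[OF s] graft_idle_trees_on[OF t] Int_Un_distrib2)
    have "(insert w (B \<union> C) - {w}) \<union> D = A" using w A by auto
    with 5 show ?thesis by simp
  qed
  show ?thesis
    using assms(3,4)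
  proof (induction arbitrary: A rule: tree_equiv.induct)
    case (refl t)
    then show ?case
      using scale.subspace_0[OF J_subspace[OF trees_on_finite]] by simp
  next
    case (sym s t)
    then have "basis s - basis t \<in> J A" "label_set A"
      using tree_equiv_trees_on trees_on_finite by metis+
    then show ?case
      using scale.subspace_neg[OF J_subspace, of A "basis s - basis t"] by simp
  next
    case (trans s t u)
    then have "basis s - basis t \<in> J A" "basis t - basis u \<in> J A" "label_set A"
      using tree_equiv_trees_on trees_on_finite by metis+
    then show ?case using add[of A "basis s - basis t" "basis t - basis u"] by simp
  next
    case (node s s' t t' g)
    then obtain B C where s: "s \<in> trees_on B" and t: "t \<in> trees_on C" and BC: "B \<inter> C = {}" "A = B \<union> C"
      by (elim trees_on_Node)
    have s': "s' \<in> trees_on B" using tree_equiv_trees_on node.hyps(1) s by blast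
    note fin = trees_on_finite[OF s] trees_on_finite[OF t]
    obtain p where p: "p \<notin> B \<union> C" using fin by (meson ex_fresh_label finite_UnI)
    \<comment> \<open>The arguments are exchanged one after the other: \<open>s\<close> becomes
      \<open>s'\<close> beside \<open>t\<close>, then \<open>t\<close> becomes \<open>t'\<close>
      beside \<open>s'\<close>, and the two differences telescope.\<close>
    have "basis (graft p (Node g (Leaf p) t) s) - basis (graft p (Node g (Leaf p) t) s')
        \<in> J ((insert p C - {p}) \<union> B)"
      using s t p fin BC node.IH(1)[OF s] Node_trees_on[OF Leaf_trees_on t, of p g]
      by (intro graft_right) auto
    moreover have "basis (graft p (Node g s' (Leaf p)) t) - basis (graft p (Node g s' (Leaf p)) t')
        \<in> J ((insert p B - {p}) \<union> C)"
      using s' t p fin BC node.IH(2)[OF t] Node_trees_on[OF s' Leaf_trees_on, of p g]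
      by (intro graft_right) auto
    ultimately have "basis (Node g s t) - basis (Node g s' t) \<in> J A"
      "basis (Node g s' t) - basis (Node g s' t') \<in> J A"
      using p BC by (simp_all add: graft_idle_trees_on[OF t] graft_idle_trees_on[OF s'] Un_commute)
    then show ?case
      using add[of A "basis (Node g s t) - basis (Node g s' t)"
          "basis (Node g s' t) - basis (Node g s' t')"] fin BC by simp
  next
    case (comm s t)
    then obtain B C where s: "s \<in> trees_on B" and t: "t \<in> trees_on C" and BC: "B \<inter> C = {}" "A = B \<union> C"
      by (elim trees_on_Node)
    note fin = trees_on_finite[OF s] trees_on_finite[OF t]
    obtain p where p: "p \<notin> B \<union> C" using fin by (meson ex_fresh_label finite_UnI)
    obtain q where q: "q \<notin> insert p (B \<union> C)" using fin by (meson ex_fresh_label finite_UnI finite_insert)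
    \<comment> \<open>The first tree of the relation has its leaves in the order \<open>2\<close>,
      \<open>1\<close>; sending \<open>2\<close> to \<open>p\<close> and \<open>1\<close> to
      \<open>q\<close> puts \<open>p\<close> on the left, where \<open>s\<close> is to go.\<close>
    define \<sigma> where "\<sigma> = (\<lambda>i::nat. if i = 1 then q else p)"
    have bij: "bij_betw \<sigma> {1, 2} {p, q}" using q by (auto simp: bij_betw_def \<sigma>_def)
    have "basis (Node Gen_m (Leaf 2) (Leaf 1)) - basis (Node Gen_m (Leaf 1) (Leaf 2)) \<in> J {1, 2}"
      by (intro rel' keys_diff) (auto simp: CP_relations_eq trees_on_def)
    from relabel[OF _ bij this]
    have "basis (Node Gen_m (Leaf p) (Leaf q)) - basis (Node Gen_m (Leaf q) (Leaf p)) \<in> J {p, q}"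
      by (simp add: \<sigma>_def)
    from graft_left[OF _ _ _ _ this s, of p]
    have 1: "basis (Node Gen_m s (Leaf q)) - basis (Node Gen_m (Leaf q) s) \<in> J (({p, q} - {p}) \<union> B)"
      using p q fin by simp
    have "({p, q} - {p}) \<union> B = insert q B" using p q by auto
    with 1 have 2: "basis (Node Gen_m s (Leaf q)) - basis (Node Gen_m (Leaf q) s) \<in> J (insert q B)" by simp
    from graft_left[OF _ _ _ _ 2 t, of q]
    have 3: "basis (Node Gen_m s t) - basis (Node Gen_m t s) \<in> J ((insert q B - {q}) \<union> C)"
      using q fin BC by (simp add: graft_idle_trees_on[OF s])
    have "insert q B - {q} = B" using q by auto
    with 3 show ?case using BC by simp
  next
    case (assoc s t u)
    show ?case
      by (rule three[OF rel'[OF _ keys_diff] assoc.prems]) (use assoc.prems in \<open>auto simp: CP_relations_eq trees_on_def\<close>)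
  next
    case (action s t u)
    show ?case
      by (rule three[OF rel'[OF _ keys_diff] action.prems]) (use action.prems in \<open>auto simp: CP_relations_eq trees_on_def\<close>)
  qed
qed


text \<open>Moving each tree of \<open>x\<close> to one chosen tree with the same value changes
  \<open>x\<close> by an element of \<open>J\<close>. The result depends on \<open>x\<close> only
  through \<open>lin eval_tree x\<close>, so it is zero.\<close>

lemma kernel_subset_generated_ideal:
  assumes A: "label_set A"
  shows "{x \<in> component free_operad A. lin eval_tree x = 0}
    \<subseteq> generated_ideal free_operad (CP_relations :: ((generator, nat) tree \<Rightarrow>\<^sub>0 'k::field) set) A"
  unfolding generated_ideal_def
proof (intro Inter_greatest subsetI, clarify)
  fix J :: "nat set \<Rightarrow> ((generator, nat) tree \<Rightarrow>\<^sub>0 'k) set" and x :: "(generator, nat) tree \<Rightarrow>\<^sub>0 'k"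
  assume J: "operadic_ideal free_operad J"
    and rel: "\<forall>B. label_set B \<longrightarrow> CP_relations \<inter> component free_operad B \<subseteq> J B"
    and x: "x \<in> component free_operad A" "lin eval_tree x = 0"
  \<comment> \<open>Any section of evaluation will do, so the representative is an arbitrary choice
    rather than a computed normal form.\<close>
  define rep where "rep r = (SOME t. t \<in> trees_on A \<and> eval_tree t = r)" for r :: "nat rel"
  have rep: "rep (eval_tree t) \<in> trees_on A \<and> eval_tree (rep (eval_tree t)) = eval_tree t"
    if "t \<in> trees_on A" for t
    unfolding rep_def by (rule someI[of _ t]) (simp add: that)
  have J_subspace: "scale.subspace (J A)" using operadic_idealD(1)[OF J A] by simp
  have "Poly_Mapping.keys x \<subseteq> trees_on A" using x(1) by simp
  then have "x - lin (\<lambda>t. rep (eval_tree t)) x \<in> J A"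
  proof (induction x rule: free_induct)
    case zero
    then show ?case using scale.subspace_0[OF J_subspace] by simp
  next
    case (add x y)
    from scale.subspace_add[OF J_subspace add.IH] show ?case
      by (simp add: lin_add algebra_simps)
  next
    case (scale c x)
    from scale.subspace_scale[OF J_subspace scale.IH, of c] show ?case
      by (simp add: lin_scale scale.scale_right_diff_distrib)
  next
    case (basis t)
    \<comment> \<open>The one place where completeness of the congruence enters.\<close>
    have "t \<approx> rep (eval_tree t)"
      using rep[OF basis] by (intro tree_equiv_complete[OF basis]) auto
    then show ?case using tree_equiv_in_ideal[OF J _ _ basis] rel by simp
  qed
  moreover have "lin (\<lambda>t. rep (eval_tree t)) x = 0"
    using x(2) by (simp add: lin_lin[symmetric])
  ultimately show "x \<in> J A" by simp
qed

lemma lin_eval_tree_surjective: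
  "lin eval_tree ` component free_operad A = (CP A :: (nat rel \<Rightarrow>\<^sub>0 'k::field) set)"
proof
  show "lin eval_tree ` component free_operad A \<subseteq> (CP A :: (nat rel \<Rightarrow>\<^sub>0 'k) set)"
    using keys_lin_subset[OF _ order_refl, of _ "trees_on A" eval_tree]
    by (simp only: CP_eq image_subset_iff free_operad_sel mem_Collect_eq ball_simps) blast
  show "(CP A :: (nat rel \<Rightarrow>\<^sub>0 'k) set) \<subseteq> lin eval_tree ` component free_operad A"
  proof
    fix y :: "nat rel \<Rightarrow>\<^sub>0 'k"
    assume "y \<in> CP A"
    then have y: "Poly_Mapping.keys y \<subseteq> eval_tree ` trees_on A" by (simp add: CP_eq)
    let ?x = "lin (inv_into (trees_on A) eval_tree) y"
    have "Poly_Mapping.keys ?x \<subseteq> trees_on A"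
      by (rule keys_lin_subset[OF y]) (auto intro: inv_into_into)
    moreover have "lin eval_tree ?x = y"
      unfolding lin_lin by (rule lin_id[OF y]) (simp add: f_inv_into_f)
    ultimately show "y \<in> lin eval_tree ` component free_operad A" by force
  qed
qed

theorem theorem21:
  shows "suboperad poset_operad (CP :: nat set \<Rightarrow> (nat rel \<Rightarrow>\<^sub>0 'k::field) set)
    \<and> (\<forall>A. finite A \<and> A \<noteq> {} \<longrightarrow>
         generated_suboperad poset_operad
           {basis (gen_poset Gen_m), basis (gen_poset Gen_triangle)} A
         = (CP A :: (nat rel \<Rightarrow>\<^sub>0 'k) set))
    \<and> presented_by (CP_operad :: ('k, nat rel \<Rightarrow>\<^sub>0 'k) operad_data)
         (\<lambda>g. basis (gen_poset g)) CP_relations"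
proof (intro conjI allI impI)
  show "presented_by (CP_operad :: ('k, nat rel \<Rightarrow>\<^sub>0 'k) operad_data)
      (\<lambda>g. basis (gen_poset g)) CP_relations"
    unfolding presented_by_def
  proof (intro exI[of _ "lin eval_tree"] conjI allI impI)
    show "lin eval_tree (free_generator g) = (basis (gen_poset g) :: nat rel \<Rightarrow>\<^sub>0 'k)" for g
      unfolding free_generator_def lin_basis eval_generator ..
    show "lin eval_tree ` component free_operad A = component (CP_operad :: ('k, _) operad_data) A"
      if "label_set A" for A
      by (simp only: lin_eval_tree_surjective CP_operad_sel)
    show "{x \<in> component free_operad A. lin eval_tree x = (0 :: nat rel \<Rightarrow>\<^sub>0 'k)}
        = generated_ideal free_operad CP_relations A" if "label_set A" for A
      using that by (intro subset_antisym kernel_subset_generated_ideal generated_ideal_subset_kernel)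
  qed (rule operad_morphism_lin_eval_tree)
qed (use suboperad_CP generated_suboperad_CP in blast)+

end
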